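(* Let the Smoothness, Hessian, Gradient and Merit-parameter Assumptions of the context hold for the iterates generated by the exact algorithm of the context. Let $\alpha_k\in[\nu,\nu+\theta\beta_k]$ for all $k$, where $\theta>0$ and $$\nu\in\Big(0,\min\Big\{\frac{\sigma\kappa_v\kappa_c^{-1}}{2(\tau_{\min}L+\Gamma)\omega^2},\,1-\theta\kappa_\beta\Big\}\Big].$$ For any $K\in\mathbb N$, let $\beta_k:=\beta=\eta/\sqrt K$ for all $k\in[0,K-1]$, where $\eta>0$. Let $y_k^{\mathrm{true}}:=-(J_k^T)^+(\nabla f(x_k)+H_kv_k+H_ku_k^{\mathrm{true}})$. Then $$\frac1K\sum_{k=0}^{K-1}\mathbb E\big[\|\nabla f(x_k)+J_k^Ty_k^{\mathrm{true}}\|^2\big]\le\frac{2\kappa_H^2\kappa_2}{\nu\eta\tau_{\min}\zeta\sqrt K}+\frac{4\kappa_H^2\kappa_c\kappa_0\kappa_2}{\nu\sigma\kappa_v\zeta K}.$$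
   Context: Problem: minimize $f(x)$ over $x\in\mathbb R^n$ subject to $c(x)=0$, with $f:\mathbb R^n\to\mathbb R$ (an expectation) and $c:\mathbb R^n\to\mathbb R^m$. $\|\cdot\|$ is the Euclidean norm (and induced matrix norm); $A^+$ is the Moore-Penrose pseudoinverse. $J(x)=\nabla c(x)^T\in\mathbb R^{m\times n}$, $c_k=c(x_k)$, $J_k=J(x_k)$, $f_0=f(x_0)$. Smoothness Assumption: there is an open convex set $\mathcal X\subset\mathbb R^n$ containing all iterates $x_k$; on $\mathcal X$, $f$ is continuously differentiable and bounded, $\nabla f$ is bounded and Lipschitz with constant $L>0$, $c$ is continuously differentiable and bounded, $J$ is bounded and Lipschitz with constant $\Gamma>0$. Consequently there are constants $f_{\inf}\in\mathbb R$, $\kappa_g,\kappa_c,\kappa_J>0$ with $f_{\inf}\le f(x_k)$, $\|\nabla f(x_k)\|\le\kappa_g$, $\|c_k\|\le\kappa_c$, $\|J_k\|\le\kappa_J$ for all $k$; these are fixed. Hessian Assumption: for all $k$, $H_k$ is a symmetric $n\times n$ matrix chosen independently from $g_k$, $\|H_k\|\le\kappa_H$, and there is $\zeta>0$ with $u^TH_ku\ge\zeta\|u\|^2$ for all $u\in\mathrm{Null}(J_k)$. Gradient Assumption: for all $k$, the stochastic gradient estimate $g_k$ satisfies $\mathbb E_k[g_k]=\nabla f(x_k)$ and $\mathbb E_k[\|g_k-\nabla f(x_k)\|^2]\le M$ for some $M>0$, where $\mathbb E_k$ is the conditional expectation given the history up to $x_k$ (under which $x_k,v_k,H_k,\beta_k$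 are treated as known). Exact algorithm: given $x_0$, at iteration $k$: (1) compute $v_k\in\mathrm{Range}(J_k^T)$, independently of $g_k$, as an approximate solution of $\min_v\frac12\|c_k+J_kv\|^2$ s.t. $\|v\|\le\omega\|J_k^Tc_k\|$ (with $\omega>0$ fixed) that is feasible and satisfies the Cauchy decrease condition $\|c_k\|-\|c_k+J_kv_k\|\ge\epsilon_v(\|c_k\|-\|c_k+\alpha_k^CJ_kv_k^C\|)$, where $\epsilon_v\in(0,1]$ is fixed, $v_k^C=-J_k^Tc_k$, and $\alpha_k^C$ minimizes $\frac12\|c_k+\alpha J_kv_k^C\|^2$ over $\alpha\le\omega$; (2) draw $g_k$ and let $u_k$ be the unique minimizer of $(g_k+H_kv_k)^Tu+\frac12u^TH_ku$ s.t. $J_ku=0$; (3) with a predefined $\beta_k>0$, $\beta_k\le\kappa_\beta$ for all $k$ ($\kappa_\beta>0$ a constant), set $d_k=\beta_ku_k+v_k$; (4) choose $\alpha_k>0$ and set $x_{k+1}=x_k+\alpha_kd_k$. The stepsize $\alpha_k$ may depend on $g_k$. True quantities: $u_k^{\mathrm{true}}$ is the minimizer of $(\nabla f(x_k)+H_kv_k)^Tu+\frac12u^TH_ku$ s.t. $J_ku=0$, and $d_k^{\mathrm{true}}=\beta_ku_k^{\mathrm{true}}+v_k$. Merit-parameter Assumption (with fixed $\sigma\in(0,1)$): there is $\tau_{\min}>0$ such that for all $k$, $\tau_{\min}(\nabla f(x_k)^Td_k^{\mathrm{true}}+\beta_k(u_k^{\mathrm{true}})^TH_ku_k^{\mathrm{true}})\le(1-\sigma)(\|c_k\|-\|c_k+J_kv_k\|)$.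 Constants: $\kappa_v>0$ is a constant such that $\|c_k\|(\|c_k\|-\|c_k+J_kv_k\|)\ge\kappa_v\|J_k^Tc_k\|^2$ for all $k$ (such a constant exists under the Smoothness Assumption); $\kappa_u:=\zeta^{-1}(\kappa_g+\kappa_H\omega\kappa_J\kappa_c)$; $\kappa_0:=\omega^2(2\kappa_H+2\zeta^{-1}\kappa_H^2+\zeta)$; $\kappa_1:=\frac12(\tau_{\min}L+\Gamma)(\zeta^{-1}\kappa_H\kappa_u^2+\zeta^{-2}M)+\theta\kappa_g\tau_{\min}\zeta^{-1}\sqrt M+\theta^2(\tau_{\min}L+\Gamma)\omega^2\kappa_J^2\kappa_c^2$; $\kappa_2:=\tau_{\min}(f_0-f_{\inf})+\|c_0\|+\eta^2\kappa_1$. *)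

theory Defs
  imports "HOL-Probability.Probability"
begin

text \<open>
  A random iterate is a function \<open>nat \<Rightarrow> 's \<Rightarrow> _\<close> of the iteration index and the outcome.
  The instance norm of \<^typ>\<open>real^'n^'m\<close> is the Frobenius norm, so the norm induced by the
  Euclidean norms is written with \<^const>\<open>onorm\<close>.
\<close>

abbreviation op_norm :: "real^'n^'m \<Rightarrow> real" where
  "op_norm A \<equiv> onorm ((*v) A)"

definition is_pinv :: "real^'n^'m \<Rightarrow> real^'m^'n \<Rightarrow> bool" where
  "is_pinv A B \<longleftrightarrow>
     A ** B ** A = A \<and> B ** A ** B = B \<and>
     transpose (A ** B) = A ** B \<and> transpose (B ** A) = B ** A"

definition pinv :: "real^'n^'m \<Rightarrow> real^'m^'n" where
  "pinv A = (THE B. is_pinv A B)"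

text \<open>
  \<open>gradf\<close> is the gradient of \<open>f\<close> and \<open>J\<close> the \<open>m \<times> n\<close> Jacobian of \<open>c\<close>, both on \<open>X\<close>;
  \<open>X\<close> is open, so they are uniquely determined there.
\<close>

definition smoothness_assumption ::
  "'s measure \<Rightarrow> (nat \<Rightarrow> 's \<Rightarrow> real^'n) \<Rightarrow> (real^'n) set \<Rightarrow>
   (real^'n \<Rightarrow> real) \<Rightarrow> (real^'n \<Rightarrow> real^'n) \<Rightarrow>
   (real^'n \<Rightarrow> real^'m) \<Rightarrow> (real^'n \<Rightarrow> real^'n^'m) \<Rightarrow> real \<Rightarrow> real \<Rightarrow> bool"
where
  "smoothness_assumption P x X f gradf c J L \<Gamma> \<longleftrightarrow>
     open X \<and> convex X \<and> (\<forall>k. \<forall>s\<in>space P. x k s \<in> X) \<and>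
     (\<forall>z\<in>X. GDERIV f z :> gradf z) \<and> continuous_on X gradf \<and>
     bounded (f ` X) \<and> bounded (gradf ` X) \<and>
     0 < L \<and> L-lipschitz_on X gradf \<and>
     (\<forall>z\<in>X. (c has_derivative (*v) (J z)) (at z)) \<and> continuous_on X J \<and>
     bounded (c ` X) \<and> bounded (J ` X) \<and>
     0 < \<Gamma> \<and> (\<forall>y\<in>X. \<forall>z\<in>X. op_norm (J y - J z) \<le> \<Gamma> * norm (y - z))"

definition hessian_assumption ::
  "real^'n^'m \<Rightarrow> real^'n^'n \<Rightarrow> real \<Rightarrow> real \<Rightarrow> bool"
where
  "hessian_assumption Jk Hk \<kappa>\<^sub>H \<zeta> \<longleftrightarrow>
     transpose Hk = Hk \<and> op_norm Hk \<le> \<kappa>\<^sub>H \<and>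
     (\<forall>u. Jk *v u = 0 \<longrightarrow> u \<bullet> (Hk *v u) \<ge> \<zeta> * (norm u)\<^sup>2)"

text \<open>
  \<open>F k\<close> is the history up to \<open>x\<^sub>k\<close>. The conditional mean of a vector is taken componentwise.
  The conditional second moment is stated with the \<open>ennreal\<close>-valued conditional expectation,
  because \<^const>\<open>real_cond_exp\<close> replaces the value \<open>\<infinity>\<close> by \<open>0\<close>. The second clause thus forces
  \<open>g k - gradf \<circ> x k\<close> to be square integrable, so (\<open>gradf\<close> being bounded along the iterates) \<open>g k\<close>
  is integrable and the first clause speaks about a genuine conditional expectation.
\<close>

definition gradient_assumption ::
  "'s measure \<Rightarrow> (nat \<Rightarrow> 's measure) \<Rightarrow> (real^'n \<Rightarrow> real^'n) \<Rightarrow>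
   (nat \<Rightarrow> 's \<Rightarrow> real^'n) \<Rightarrow> (nat \<Rightarrow> 's \<Rightarrow> real^'n) \<Rightarrow> real \<Rightarrow> bool"
where
  "gradient_assumption P F gradf x g M \<longleftrightarrow>
     (\<forall>k. g k \<in> borel_measurable P \<and>
        (\<forall>i. AE s in P. real_cond_exp P (F k) (\<lambda>s. g k s $ i) s = gradf (x k s) $ i) \<and>
        (AE s in P. nn_cond_exp P (F k) (\<lambda>s. ennreal ((norm (g k s - gradf (x k s)))\<^sup>2)) s
                      \<le> ennreal M))"

text \<open>
  \<open>normal_step\<close> states what is required of \<open>v\<^sub>k\<close>, for \<open>ck = c\<^sub>k\<close> and \<open>Jk = J\<^sub>k\<close>. If
  \<open>Jk *v vC = 0\<close>, the minimizer \<open>\<alpha>C\<close> is not unique, but the Cauchy decrease condition does not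
  depend on the choice.
\<close>

definition normal_step ::
  "real \<Rightarrow> real \<Rightarrow> real^'m \<Rightarrow> real^'n^'m \<Rightarrow> real^'n \<Rightarrow> bool"
where
  "normal_step \<omega> \<epsilon>\<^sub>v ck Jk v \<longleftrightarrow>
     v \<in> range ((*v) (transpose Jk)) \<and>
     norm v \<le> \<omega> * norm (transpose Jk *v ck) \<and>
     (let vC = - (transpose Jk *v ck) in
      \<exists>\<alpha>C. is_arg_min (\<lambda>a. 1/2 * (norm (ck + a *\<^sub>R (Jk *v vC)))\<^sup>2) (\<lambda>a. a \<le> \<omega>) \<alpha>C \<and>
           norm ck - norm (ck + Jk *v v) \<ge> \<epsilon>\<^sub>v * (norm ck - norm (ck + \<alpha>C *\<^sub>R (Jk *v vC))))"

text \<open>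
  The tangential subproblem for a gradient vector \<open>q\<close>; it defines \<open>u\<^sub>k\<close> for \<open>q = g\<^sub>k\<close> and
  \<open>u\<^sub>k\<^sup>t\<^sup>r\<^sup>u\<^sup>e\<close> for \<open>q = \<nabla>f(x\<^sub>k)\<close>. Under \<open>hessian_assumption\<close> the minimizer is unique.
\<close>

definition tangential_step ::
  "real^'n \<Rightarrow> real^'n^'n \<Rightarrow> real^'n^'m \<Rightarrow> real^'n \<Rightarrow> real^'n \<Rightarrow> bool"
where
  "tangential_step q Hk Jk v u \<longleftrightarrow>
     is_arg_min (\<lambda>w. (q + Hk *v v) \<bullet> w + 1/2 * (w \<bullet> (Hk *v w))) (\<lambda>w. Jk *v w = 0) u"

text \<open>
  Independence of \<open>v\<^sub>k\<close> and \<open>H\<^sub>k\<close> from \<open>g\<^sub>k\<close> means that they are fixed before \<open>g\<^sub>k\<close> is drawn, that is,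
  that they are \<open>F k\<close>-measurable, like \<open>x\<^sub>k\<close>. The stepsize \<open>a k\<close> is only measurable with respect
  to \<open>P\<close> and may hence depend on \<open>g k\<close>; \<open>\<beta>\<close> is a predefined deterministic sequence.
\<close>

definition exact_algorithm ::
  "'s measure \<Rightarrow> (nat \<Rightarrow> 's measure) \<Rightarrow>
   (real^'n \<Rightarrow> real^'m) \<Rightarrow> (real^'n \<Rightarrow> real^'n^'m) \<Rightarrow>
   real \<Rightarrow> real \<Rightarrow> real \<Rightarrow> (nat \<Rightarrow> real) \<Rightarrow> real^'n \<Rightarrow>
   (nat \<Rightarrow> 's \<Rightarrow> real^'n) \<Rightarrow> (nat \<Rightarrow> 's \<Rightarrow> real^'n) \<Rightarrow>
   (nat \<Rightarrow> 's \<Rightarrow> real^'n^'n) \<Rightarrow> (nat \<Rightarrow> 's \<Rightarrow> real^'n) \<Rightarrow>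
   (nat \<Rightarrow> 's \<Rightarrow> real^'n) \<Rightarrow> (nat \<Rightarrow> 's \<Rightarrow> real^'n) \<Rightarrow> (nat \<Rightarrow> 's \<Rightarrow> real) \<Rightarrow> bool"
where
  "exact_algorithm P F c J \<omega> \<epsilon>\<^sub>v \<kappa>\<^sub>\<beta> \<beta> x0 x v H g u d a \<longleftrightarrow>
     filtration (space P) F \<and> (\<forall>k. subalgebra P (F k)) \<and>
     0 < \<omega> \<and> 0 < \<epsilon>\<^sub>v \<and> \<epsilon>\<^sub>v \<le> 1 \<and> 0 < \<kappa>\<^sub>\<beta> \<and>
     (\<forall>s\<in>space P. x 0 s = x0) \<and>
     (\<forall>k. x k \<in> borel_measurable (F k) \<and> v k \<in> borel_measurable (F k) \<and>
          H k \<in> borel_measurable (F k) \<and> a k \<in> borel_measurable P \<and>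
          0 < \<beta> k \<and> \<beta> k \<le> \<kappa>\<^sub>\<beta>) \<and>
     (\<forall>k. \<forall>s\<in>space P.
          normal_step \<omega> \<epsilon>\<^sub>v (c (x k s)) (J (x k s)) (v k s) \<and>
          tangential_step (g k s) (H k s) (J (x k s)) (v k s) (u k s) \<and>
          d k s = \<beta> k *\<^sub>R u k s + v k s \<and>
          0 < a k s \<and>
          x (Suc k) s = x k s + a k s *\<^sub>R d k s)"

end

theory Submission
  imports Defs
begin

text \<open>
  Along the iterates, the merit function \<open>\<tau>\<^sub>m\<^sub>i\<^sub>n f + \<parallel>c\<parallel>\<close> decreases up to an error that is bounded
  using the Lipschitz constants. The stochastic error \<open>u\<^sub>k - u\<^sub>k\<^sup>t\<^sup>r\<^sup>u\<^sup>e\<close> is a linear image of the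
  gradient noise under a map that is fixed by the history; hence its first-order contribution, taken
  with the minimal stepsize \<open>\<nu>\<close>, has mean zero, and what remains, including the effect of stepsizes
  that depend on \<open>g\<^sub>k\<close>, is of order \<open>\<beta>\<^sup>2\<close>. Telescoping
  bounds the sums of the expectations of \<open>\<parallel>c\<^sub>k\<parallel> - \<parallel>c\<^sub>k + J\<^sub>k v\<^sub>k\<parallel>\<close> and of the curvature
  of \<open>u\<^sub>k\<^sup>t\<^sup>r\<^sup>u\<^sup>e\<close>. By the first-order optimality conditions the residual equals
  \<open>- H\<^sub>k (v\<^sub>k + u\<^sub>k\<^sup>t\<^sup>r\<^sup>u\<^sup>e)\<close>, and the two summands, which are orthogonal, are controlled by these two
  quantities.
\<close>

text \<open>No rank condition is imposed on the Jacobians, so the KKT matrix need not be invertible,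
  and the projection onto the null space of \<open>J\<close> may jump as \<open>J\<close> varies.
  The tangential steps and the adjoint solutions are given only pointwise, yet the noise averages
  out only against vectors that are measurable with respect to \<open>F k\<close>. Much of the work
  therefore goes into measurability: the optimality conditions are rewritten as an invertible square
  system containing the null-space projection, to which Cramer's rule applies.

  A stepsize correlated with \<open>g k\<close> would spoil the mean-zero argument. Its excess over
  \<nu> is at most \<open>\<theta> * \<beta> k\<close> and multiplies a term that already carries
  the factor \<open>\<beta> k\<close>; this is why the admissible interval has length proportional
  to \<open>\<beta> k\<close>.

  With \<open>\<beta> k = \<eta> / sqrt K\<close>, the K second-order errors add up to a constant.
  The decrease of the linearized constraint enters the sum without a factor \<beta>, the curvature
  term with one; hence the two rates \<open>1 / K\<close> and \<open>1 / sqrt K\<close>.\<close>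

declare transpose_matrix_vector [simp del]

section \<open>Orthogonal splitting into null space and row space\<close>

lemma transpose_inner:
  fixes A :: "real^'n^'m"
  shows "(transpose A *v y) \<bullet> z = y \<bullet> (A *v z)"
  using dot_lmul_matrix[of y A z] by (simp add: transpose_matrix_vector)

lemma symmetric_inner:
  fixes A :: "real^'n^'n"
  assumes "transpose A = A"
  shows "(A *v y) \<bullet> z = y \<bullet> (A *v z)"
  using transpose_inner[of A y z] assms by simp

text \<open>The orthogonal complement of the range of \<open>transpose A\<close> is the null space
  of \<open>A\<close>, whatever the rank of \<open>A\<close>.\<close>

lemma null_range_decomp:
  fixes A :: "real^'n^'m"
  obtains q z where "p = q + transpose A *v z" "A *v q = 0"
proof -
  let ?W = "range ((*v) (transpose A))"
  have "subspace ?W"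
    by (intro linear_subspace_image) auto
  then obtain w q where p: "p = w + q" "w \<in> ?W" "q \<in> ?W\<^sup>\<bottom>"
    using subspace_sum_orthogonal_comp[of ?W] by (metis UNIV_I set_plus_elim)
  then have "y \<bullet> (A *v q) = 0" for y
    by (auto simp: orthogonal_comp_def orthogonal_def simp flip: transpose_inner)
  then have "A *v q = 0"
    using inner_eq_zero_iff by blast
  then show thesis
    using p that by (auto simp: add.commute)
qed

text \<open>The null-space component of \<open>p\<close> is orthogonal to \<open>p\<close> and to
  the row-space component, hence to itself. This supplies Lagrange multipliers without a constraint
  qualification.\<close>

lemma orthogonal_null_in_range:
  fixes A :: "real^'n^'m"
  assumes "\<And>z. A *v z = 0 \<Longrightarrow> p \<bullet> z = 0"
  shows "p \<in> range ((*v) (transpose A))"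
proof -
  obtain q z where p: "p = q + transpose A *v z" "A *v q = 0"
    by (rule null_range_decomp)
  have "p \<bullet> q = 0"
    using assms p by blast
  then have "q \<bullet> q = 0"
    using p by (simp add: inner_add_left transpose_inner)
  then show ?thesis
    using p by auto
qed

lemma range_orthogonal_null:
  fixes A :: "real^'n^'m"
  assumes "p \<in> range ((*v) (transpose A))" "A *v z = 0"
  shows "p \<bullet> z = 0"
  using assms by (auto simp: transpose_inner)

subsection \<open>The Moore-Penrose inverse\<close>

text \<open>The component of a right-hand side orthogonal to the range of \<open>A\<close> is
  annihilated by \<open>transpose A\<close>, so the normal equations are always solvable. The
  solutions for the unit vectors are the columns of \<open>B\<close>.\<close>

lemma normal_equation_solvable:
  fixes A :: "real^'n^'m"
  obtains B :: "real^'m^'n" where "transpose A ** A ** B = transpose A"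
proof -
  have "\<exists>z. (transpose A ** A) *v z = transpose A *v y" for y
  proof -
    obtain q z where "y = q + transpose (transpose A) *v z" "transpose A *v q = 0"
      by (rule null_range_decomp)
    then show ?thesis
      by (auto simp: matrix_vector_right_distrib matrix_vector_mul_assoc intro!: exI[of _ z])
  qed
  then obtain Z where Z: "\<And>y. (transpose A ** A) *v Z y = transpose A *v y"
    by metis
  define B :: "real^'m^'n" where "B = (\<chi> i j. Z (axis j 1) $ i)"
  have "column j B = Z (axis j 1)" for j
    by (simp add: B_def column_def vec_eq_iff)
  then have "(transpose A ** A ** B) *v axis j 1 = transpose A *v axis j 1" for j
    by (subst matrix_vector_mul_assoc[symmetric]) (simp only: matrix_vector_mult_basis[of B] Z)
  then have "column j (transpose A ** A ** B) = column j (transpose A)" for j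
    by (simp only: matrix_vector_mult_basis)
  then have "transpose A ** A ** B = transpose A"
    by (simp add: column_def vec_eq_iff)
  then show thesis ..
qed

text \<open>The normal equation gives
  \<open>transpose (A ** B) ** (A ** B) = transpose (A ** B)\<close>. The left side is symmetric, so
  \<open>A ** B\<close> is an orthogonal projection.\<close>

lemma least_squares_inverse:
  fixes A :: "real^'n^'m"
  obtains B :: "real^'m^'n" where "A ** B ** A = A" "transpose (A ** B) = A ** B"
proof -
  obtain B where B: "transpose A ** A ** B = transpose A"
    by (rule normal_equation_solvable)
  have "transpose (A ** B) ** (A ** B) = transpose B ** (transpose A ** A ** B)"
    by (simp add: matrix_transpose_mul matrix_mul_assoc)
  also have "\<dots> = transpose (A ** B)"
    by (simp add: B matrix_transpose_mul)
  finally have 1: "transpose (A ** B) ** (A ** B) = transpose (A ** B)" .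
  then have sym: "transpose (A ** B) = A ** B"
    using matrix_transpose_mul[of "transpose (A ** B)" "A ** B"] by (simp only: transpose_transpose)
  have "transpose (transpose A ** (A ** B)) = A"
    using B by (simp add: matrix_mul_assoc)
  then have "transpose (A ** B) ** A = A"
    by (simp add: matrix_transpose_mul[of "transpose A"])
  then show thesis
    using sym that by simp
qed

text \<open>Two one-sided inverses are combined: \<open>B\<close> makes \<open>A ** B\<close>
  symmetric, and \<open>D\<close>, transposed from such an inverse of \<open>transpose A\<close>,
  makes \<open>D ** A\<close> symmetric. The product \<open>D ** A ** B\<close> inherits both
  symmetries, because its products with \<open>A\<close> are \<open>A ** B\<close> and
  \<open>D ** A\<close>.\<close>

lemma is_pinv_exists: "\<exists>B. is_pinv A B"
proof -
  obtain B where B: "A ** B ** A = A" "transpose (A ** B) = A ** B"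
    by (rule least_squares_inverse)
  obtain C where C: "transpose A ** C ** transpose A = transpose A"
    "transpose (transpose A ** C) = transpose A ** C"
    by (rule least_squares_inverse)
  define D where "D = transpose C"
  have "transpose (transpose A ** C ** transpose A) = A"
    using C by simp
  then have D1: "A ** D ** A = A"
    by (simp add: D_def matrix_transpose_mul matrix_mul_assoc)
  have D2: "transpose (D ** A) = D ** A"
    using C(2) by (simp add: D_def matrix_transpose_mul)
  have eq1: "A ** (D ** A ** B) = A ** B"
    by (simp only: matrix_mul_assoc D1)
  have "D ** A ** B ** A = D ** (A ** B ** A)"
    by (simp only: matrix_mul_assoc)
  then have eq2: "D ** A ** B ** A = D ** A"
    by (simp only: B)
  have "D ** A ** B ** A ** (D ** A ** B) = D ** (A ** D ** A) ** B"
    by (simp only: eq2) (simp only: matrix_mul_assoc)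
  then have "D ** A ** B ** A ** (D ** A ** B) = D ** A ** B"
    by (simp only: D1)
  then have "is_pinv A (D ** A ** B)"
    unfolding is_pinv_def using B D1 D2 eq1 eq2 by simp
  then show ?thesis ..
qed

text \<open>\<open>A ** B\<close> and \<open>A ** C\<close> are symmetric projections onto the same
  range and so coincide; likewise \<open>B ** A\<close> and \<open>C ** A\<close>. Then
  \<open>B = B ** A ** B = C ** A ** C = C\<close>.\<close>

lemma is_pinv_unique:
  assumes B: "is_pinv A B" and C: "is_pinv A C"
  shows "B = C"
proof -
  note B' = B[unfolded is_pinv_def] and C' = C[unfolded is_pinv_def]
  have "A ** B = (A ** C) ** (A ** B)"
    using C' by (simp add: matrix_mul_assoc)
  also have "\<dots> = transpose ((A ** B) ** (A ** C))"
    by (subst matrix_transpose_mul) (simp only: B' C')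
  also have "\<dots> = A ** C"
    using B' C' by (simp add: matrix_mul_assoc)
  finally have AB: "A ** B = A ** C" .
  have "B ** A = B ** (A ** C ** A)"
    by (simp only: C')
  also have "\<dots> = (B ** A) ** (C ** A)"
    by (simp only: matrix_mul_assoc)
  also have "\<dots> = transpose ((C ** A) ** (B ** A))"
    by (subst matrix_transpose_mul) (simp only: B' C')
  also have "(C ** A) ** (B ** A) = C ** (A ** B ** A)"
    by (simp only: matrix_mul_assoc)
  also have "transpose (C ** (A ** B ** A)) = C ** A"
    by (simp only: B' C')
  finally have BA: "B ** A = C ** A" .
  have "B = B ** (A ** B)"
    using B by (simp add: is_pinv_def matrix_mul_assoc)
  also have "\<dots> = C ** A ** C"
    by (simp only: AB matrix_mul_assoc BA)
  also have "\<dots> = C"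
    using C by (simp add: is_pinv_def)
  finally show ?thesis .
qed

lemma is_pinv_pinv: "is_pinv A (pinv A)"
proof -
  have "\<exists>!B. is_pinv A B"
    using is_pinv_exists is_pinv_unique by blast
  then show ?thesis
    unfolding pinv_def by (rule theI')
qed

lemma pinv_range:
  assumes "p \<in> range ((*v) A)"
  shows "A *v (pinv A *v p) = p"
proof -
  obtain z where "p = A *v z"
    using assms by blast
  moreover have "A ** pinv A ** A = A"
    using is_pinv_pinv[of A] by (simp add: is_pinv_def)
  ultimately show ?thesis
    by (simp only: matrix_vector_mul_assoc matrix_mul_assoc)
qed

subsection \<open>Measurability of solutions of linear systems\<close>

lemma borel_measurable_vec_nth:
  fixes b :: "'a \<Rightarrow> 'b::euclidean_space^'n"
  assumes "b \<in> borel_measurable N"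
  shows "(\<lambda>s. b s $ i) \<in> borel_measurable N"
proof (rule borel_measurable_continuous_on[OF _ assms])
  show "continuous_on UNIV (\<lambda>x :: 'b^'n. x $ i)"
    by (rule linear_continuous_on) (rule bounded_linear_vec_nth)
qed

lemma borel_measurable_vec_lambda:
  fixes b :: "'a \<Rightarrow> 'n::finite \<Rightarrow> 'b::euclidean_space"
  assumes "\<And>i. (\<lambda>s. b s i) \<in> borel_measurable N"
  shows "(\<lambda>s. \<chi> i. b s i) \<in> borel_measurable N"
proof (rule borel_measurable_euclidean_space[THEN iffD2], rule ballI)
  fix e :: "'b^'n" assume "e \<in> Basis"
  then obtain i u where "e = axis i u"
    by (auto simp: Basis_vec_def)
  then have "(\<lambda>s. (\<chi> i. b s i) \<bullet> e) = (\<lambda>s. b s i \<bullet> u)"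
    by (simp add: inner_axis)
  then show "(\<lambda>s. (\<chi> i. b s i) \<bullet> e) \<in> borel_measurable N"
    using borel_measurable_inner[OF assms[of i] borel_measurable_const[of u]] by (simp only:)
qed

lemma borel_measurable_matrix_vector_mult:
  fixes A :: "'a \<Rightarrow> real^'n^'m"
  assumes "A \<in> borel_measurable N" "b \<in> borel_measurable N"
  shows "(\<lambda>s. A s *v b s) \<in> borel_measurable N"
  unfolding matrix_vector_mult_def
  by (intro borel_measurable_vec_lambda borel_measurable_sum borel_measurable_times
      borel_measurable_vec_nth assms)

lemma borel_measurable_matrix_mult:
  fixes A :: "'a \<Rightarrow> real^'n^'m" and B :: "'a \<Rightarrow> real^'k^'n"
  assumes "A \<in> borel_measurable N" "B \<in> borel_measurable N"
  shows "(\<lambda>s. A s ** B s) \<in> borel_measurable N"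
  unfolding matrix_matrix_mult_def
  by (intro borel_measurable_vec_lambda borel_measurable_sum borel_measurable_times
      borel_measurable_vec_nth assms)

lemma borel_measurable_transpose:
  fixes A :: "'a \<Rightarrow> real^'n^'m"
  assumes "A \<in> borel_measurable N"
  shows "(\<lambda>s. transpose (A s)) \<in> borel_measurable N"
  unfolding transpose_def
  by (intro borel_measurable_vec_lambda borel_measurable_vec_nth assms)

lemma borel_measurable_det:
  fixes A :: "'a \<Rightarrow> real^'n^'n"
  assumes "A \<in> borel_measurable N"
  shows "(\<lambda>s. det (A s)) \<in> borel_measurable N"
  unfolding det_def
  by (intro borel_measurable_sum borel_measurable_times borel_measurable_prod
      borel_measurable_vec_nth borel_measurable_const assms)

lemma injective_matrix:
  fixes A :: "real^'n^'n"
  assumes "\<And>z. A *v z = 0 \<Longrightarrow> z = 0"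
  shows "det A \<noteq> 0" "\<exists>w. A *v w = b"
proof -
  have "\<exists>B. B ** A = mat 1"
    using assms by (simp add: matrix_left_invertible_ker)
  then have inv: "invertible A"
    by (simp add: invertible_left_inverse)
  then show "det A \<noteq> 0"
    by (simp add: invertible_det_nz)
  obtain B where "A ** B = mat 1"
    using inv unfolding invertible_def by blast
  then show "\<exists>w. A *v w = b"
    by (intro exI[of _ "B *v b"]) (simp add: matrix_vector_mul_assoc)
qed

text \<open>Cramer's rule writes the unique solution as a quotient of determinants, which are
  polynomials in the entries of \<open>A\<close> and \<open>b\<close>.\<close>

lemma borel_measurable_linear_system:
  fixes A :: "'a \<Rightarrow> real^'n^'n"
  assumes "A \<in> borel_measurable N" "b \<in> borel_measurable N"
    and "\<And>s. s \<in> space N \<Longrightarrow> A s *v w s = b s"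
    and "\<And>s z. s \<in> space N \<Longrightarrow> A s *v z = 0 \<Longrightarrow> z = 0"
  shows "w \<in> borel_measurable N"
proof -
  have "w s = (\<chi> k. det (\<chi> i j. if j = k then b s $ i else A s $ i $ j) / det (A s))"
    if "s \<in> space N" for s
  proof -
    have "det (A s) \<noteq> 0"
      using assms(4)[OF that] by (rule injective_matrix(1))
    then show ?thesis
      using cramer assms(3)[OF that] by blast
  qed
  moreover have "(\<lambda>s. \<chi> k. det (\<chi> i j. if j = k then b s $ i else A s $ i $ j) / det (A s))
      \<in> borel_measurable N"
  proof (intro borel_measurable_vec_lambda borel_measurable_divide borel_measurable_det assms)
    show "(\<lambda>s. if j = k then b s $ i else A s $ i $ j) \<in> borel_measurable N" for i j k
      using assms by (cases "j = k") (auto intro!: borel_measurable_vec_nth)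
  qed
  ultimately show ?thesis
    by (subst measurable_cong)
qed

text \<open>
  The orthogonal projection onto the null space of \<open>A\<close> is the limit of the resolvents
  \<open>(I + n A\<^sup>T A)\<^sup>-\<^sup>1\<close>.
\<close>

lemma resolvent_error:
  fixes A :: "real^'n^'m"
  assumes A: "A *v q = 0" and "t > 0"
    and w: "w + t *\<^sub>R (transpose A *v (A *v w)) = q + transpose A *v z"
  shows "(norm (w - q))\<^sup>2 \<le> (norm z)\<^sup>2 / t"
proof -
  define r where "r = w - q"
  have r: "r + t *\<^sub>R (transpose A *v (A *v r)) = transpose A *v z"
    using w A by (simp add: r_def matrix_vector_mult_diff_distrib algebra_simps)
  \<comment> \<open>Testing with \<open>r\<close> turns the term in \<open>t\<close> into a square,
    which then absorbs \<open>norm (A *v r)\<close> on the right. The resulting rate depends on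
    \<open>z\<close> alone and not on the smallest nonzero singular value of
    \<open>A\<close>.\<close>
  have "r \<bullet> r + t * ((A *v r) \<bullet> (A *v r)) = z \<bullet> (A *v r)"
    using arg_cong[OF r, of "\<lambda>h. h \<bullet> r"] by (simp add: inner_add_left transpose_inner)
  then have *: "(norm r)\<^sup>2 + t * (norm (A *v r))\<^sup>2 \<le> norm z * norm (A *v r)"
    using norm_cauchy_schwarz[of z "A *v r"] by (simp add: power2_norm_eq_inner)
  have "norm z * norm (A *v r) \<le> (norm z)\<^sup>2 / t + t * (norm (A *v r))\<^sup>2"
  proof -
    have "0 \<le> (norm z - t * norm (A *v r))\<^sup>2 + norm z * (t * norm (A *v r))"
      using \<open>t > 0\<close> by simp
    then have "norm z * (t * norm (A *v r)) \<le> (norm z)\<^sup>2 + (t * norm (A *v r))\<^sup>2"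
      by (simp add: power2_diff algebra_simps)
    then show ?thesis
      using \<open>t > 0\<close> by (simp add: field_simps power2_eq_square)
  qed
  with * show ?thesis
    by (simp add: r_def)
qed

lemma resolvent_inj:
  fixes A :: "real^'n^'m"
  assumes "t > 0" "w + t *\<^sub>R (transpose A *v (A *v w)) = 0"
  shows "w = 0"
  using resolvent_error[of A 0 t w 0] assms by simp

lemma matrix_scaleR_vector_mult:
  fixes A :: "real^'n^'m"
  shows "(t *\<^sub>R A) *v b = t *\<^sub>R (A *v b)"
  by (simp add: vec_eq_iff matrix_vector_mult_def sum_distrib_left mult.assoc)

text \<open>The projection is discontinuous in \<open>A\<close> where the rank changes, but it is a
  pointwise limit of solutions of invertible systems. An arbitrary pointwise choice of
  \<open>z\<close> suffices, since \<open>z\<close> enters only the rate of convergence at each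
  outcome.\<close>

lemma borel_measurable_null_projection:
  fixes A :: "'a \<Rightarrow> real^'n^'m"
  assumes A: "A \<in> borel_measurable N" and p: "p \<in> borel_measurable N"
    and q: "\<And>s. s \<in> space N \<Longrightarrow> A s *v q s = 0"
    and z: "\<And>s. s \<in> space N \<Longrightarrow> p s = q s + transpose (A s) *v z s"
  shows "q \<in> borel_measurable N"
proof -
  \<comment> \<open>\<open>Suc n\<close> keeps the parameter positive from the first member of the
    sequence on.\<close>
  define R where "R n s = mat 1 + real (Suc n) *\<^sub>R (transpose (A s) ** A s)" for n s
  have R: "R n s *v w = w + real (Suc n) *\<^sub>R (transpose (A s) *v (A s *v w))" for n s w
    unfolding R_def matrix_vector_mult_add_rdistrib matrix_scaleR_vector_mult
      matrix_vector_mul_assoc[symmetric] matrix_vector_mul_lid ..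
  have R0: "w = 0" if "R n s *v w = 0" for n s w
    by (rule resolvent_inj[of "real (Suc n)" w "A s"]) (use that in \<open>simp_all only: R of_nat_0_less_iff zero_less_Suc\<close>)
  have "\<exists>w. R n s *v w = p s" for n s
    by (rule injective_matrix(2)) (rule R0)
  then obtain w where w: "\<And>n s. R n s *v w n s = p s"
    by metis
  have Rm: "R n \<in> borel_measurable N" for n
    unfolding R_def
    by (intro borel_measurable_add borel_measurable_scaleR borel_measurable_const
        borel_measurable_matrix_mult borel_measurable_transpose A)
  show ?thesis
  proof (rule borel_measurable_LIMSEQ_metric)
    show "w n \<in> borel_measurable N" for n
      by (rule borel_measurable_linear_system[OF Rm[of n] p]) (rule w, erule R0)
  next
    fix s assume s: "s \<in> space N"
    have "(norm (w n s - q s))\<^sup>2 \<le> (norm (z s))\<^sup>2 / real (Suc n)" for n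
    proof (rule resolvent_error[OF q[OF s]])
      show "w n s + real (Suc n) *\<^sub>R (transpose (A s) *v (A s *v w n s)) = q s + transpose (A s) *v z s"
        unfolding R[symmetric] w by (rule z[OF s])
    qed simp
    then have le: "norm ((norm (w n s - q s))\<^sup>2) \<le> (norm (z s))\<^sup>2 / real (Suc n)" for n
      by simp
    have "(\<lambda>n. (norm (z s))\<^sup>2 / real (Suc n)) \<longlonglongrightarrow> 0"
      by (rule LIMSEQ_Suc[OF lim_const_over_n])
    with le have "(\<lambda>n. (norm (w n s - q s))\<^sup>2) \<longlonglongrightarrow> 0"
      by (rule Lim_null_comparison[OF always_eventually[OF allI]])
    then have "(\<lambda>n. sqrt ((norm (w n s - q s))\<^sup>2)) \<longlonglongrightarrow> sqrt 0"
      by (rule tendsto_real_sqrt)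
    then show "(\<lambda>n. w n s) \<longlonglongrightarrow> q s"
      by (simp add: tendsto_norm_zero_iff LIM_zero_iff)
  qed
qed

text \<open>The orthogonal projection onto the null space of \<open>A\<close>, described by the
  splitting itself so that no basis or rank has to be chosen. The vector selected is unique by
  \<open>null_proj_eqI\<close>.\<close>

definition null_proj :: "real^'n^'m \<Rightarrow> real^'n \<Rightarrow> real^'n" where
  "null_proj A p = (SOME q. A *v q = 0 \<and> p - q \<in> range ((*v) (transpose A)))"

lemma null_proj:
  fixes A :: "real^'n^'m"
  shows "A *v null_proj A p = 0" "p - null_proj A p \<in> range ((*v) (transpose A))"
proof -
  obtain q z where "p = q + transpose A *v z" "A *v q = 0"
    by (rule null_range_decomp)
  then have "\<exists>q. A *v q = 0 \<and> p - q \<in> range ((*v) (transpose A))"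
    by (intro exI[of _ q]) auto
  then have "A *v null_proj A p = 0 \<and> p - null_proj A p \<in> range ((*v) (transpose A))"
    unfolding null_proj_def by (rule someI_ex)
  then show "A *v null_proj A p = 0" "p - null_proj A p \<in> range ((*v) (transpose A))"
    by simp_all
qed

lemma null_proj_inner:
  fixes A :: "real^'n^'m"
  assumes "A *v z = 0"
  shows "null_proj A p \<bullet> z = p \<bullet> z"
  using range_orthogonal_null[OF null_proj(2)[of p A] assms] by (simp add: inner_diff_left)

lemma null_proj_eqI:
  fixes A :: "real^'n^'m"
  assumes "A *v q = 0" "\<And>z. A *v z = 0 \<Longrightarrow> q \<bullet> z = p \<bullet> z"
  shows "null_proj A p = q"
proof -
  have 0: "A *v (null_proj A p - q) = 0"
    using assms null_proj(1)[of A p] by (simp add: matrix_vector_mult_diff_distrib)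
  have "(null_proj A p - q) \<bullet> (null_proj A p - q) = 0"
    using null_proj_inner[OF 0] assms(2)[OF 0] by (simp add: inner_diff_left)
  then show ?thesis by simp
qed

lemma linear_null_proj: "linear (null_proj (A :: real^'n^'m))"
proof (rule linearI)
  show "null_proj A (p + q) = null_proj A p + null_proj A q" for p q
    by (rule null_proj_eqI) (simp_all add: matrix_vector_right_distrib null_proj null_proj_inner inner_add_left)
  show "null_proj A (t *\<^sub>R p) = t *\<^sub>R null_proj A p" for t p
    by (rule null_proj_eqI) (simp_all add: matrix_vector_mult_scaleR null_proj null_proj_inner)
qed

lemma borel_measurable_null_proj:
  fixes A :: "'a \<Rightarrow> real^'n^'m"
  assumes "A \<in> borel_measurable N" "p \<in> borel_measurable N"
  shows "(\<lambda>s. null_proj (A s) (p s)) \<in> borel_measurable N"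
proof -
  have "\<exists>z. p s = null_proj (A s) (p s) + transpose (A s) *v z" for s
  proof -
    obtain y where "p s - null_proj (A s) (p s) = transpose (A s) *v y"
      using null_proj(2)[of "p s" "A s"] by blast
    then have "p s = null_proj (A s) (p s) + transpose (A s) *v y"
      by (simp only: diff_eq_eq add.commute)
    then show ?thesis ..
  qed
  then obtain z where "\<And>s. p s = null_proj (A s) (p s) + transpose (A s) *v z s"
    by metis
  then show ?thesis
    by (intro borel_measurable_null_projection[OF assms]) (rule null_proj)
qed

lemma borel_measurable_matrix_null_proj:
  fixes A :: "'a \<Rightarrow> real^'n^'m"
  assumes "A \<in> borel_measurable N"
  shows "(\<lambda>s. matrix (null_proj (A s))) \<in> borel_measurable N"
  unfolding matrix_def
  by (intro borel_measurable_vec_lambda borel_measurable_vec_nth borel_measurable_null_proj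
      borel_measurable_const assms)

subsection \<open>The reduced problem on the null space\<close>

text \<open>
  First-order optimality of \<open>w\<close> for minimizing \<open>1/2 w\<^sup>T B w - p\<^sup>T w\<close> over the null space of \<open>A\<close>.
\<close>

definition reduced_solution :: "real^'n^'m \<Rightarrow> real^'n^'n \<Rightarrow> real^'n \<Rightarrow> real^'n \<Rightarrow> bool" where
  "reduced_solution A B p w \<longleftrightarrow>
     A *v w = 0 \<and> (\<forall>z. A *v z = 0 \<longrightarrow> (B *v w) \<bullet> z = p \<bullet> z)"

text \<open>With P the null-space projection, this is \<open>I - P + P B\<close>. Relative to the
  splitting into null space and row space it is block triangular, with the compression of
  \<open>B\<close> on the null space and the identity on the row space. Its size does not depend on
  the rank of \<open>A\<close>.\<close>

definition reduced_matrix :: "real^'n^'m \<Rightarrow> real^'n^'n \<Rightarrow> real^'n^'n" where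
  "reduced_matrix A B = mat 1 + matrix (null_proj A) ** (B - mat 1)"

lemma reduced_matrix_mult:
  "reduced_matrix A B *v w = w - null_proj A w + null_proj A (B *v w)"
proof -
  have "matrix (null_proj A) *v y = null_proj A y" for y
    by (simp add: matrix_works linear_null_proj linear_matrix_vector_mul_eq)
  then show ?thesis
    unfolding reduced_matrix_def matrix_vector_mult_add_rdistrib matrix_vector_mul_assoc[symmetric]
    by (simp add: matrix_vector_mult_diff_rdistrib linear_diff[OF linear_null_proj])
qed

text \<open>One square system encodes both conditions: its row-space component forces
  \<open>w\<close> into the null space, and its null-space component is the optimality
  condition.\<close>

lemma reduced_solution_iff:
  "reduced_solution A B p w \<longleftrightarrow> reduced_matrix A B *v w = null_proj A p"
proof
  assume w: "reduced_solution A B p w"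
  have "null_proj A w = w" "null_proj A (B *v w) = null_proj A p"
    using w by (auto simp: reduced_solution_def null_proj null_proj_inner intro!: null_proj_eqI)
  then show "reduced_matrix A B *v w = null_proj A p"
    by (simp add: reduced_matrix_mult)
next
  assume w: "reduced_matrix A B *v w = null_proj A p"
  then have eq: "w - null_proj A w = null_proj A p - null_proj A (B *v w)"
    by (simp add: reduced_matrix_mult algebra_simps)
  have "A *v (w - null_proj A w) = 0"
    unfolding eq by (simp add: matrix_vector_mult_diff_distrib null_proj)
  then have "(w - null_proj A w) \<bullet> (w - null_proj A w) = 0"
    using null_proj(2) range_orthogonal_null by blast
  then have 1: "null_proj A w = w" by simp
  then have 2: "null_proj A p = null_proj A (B *v w)"
    using eq by simp
  show "reduced_solution A B p w"
    unfolding reduced_solution_def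
  proof (intro conjI allI impI)
    show "A *v w = 0"
      using null_proj(1)[of A w] 1 by simp
    show "(B *v w) \<bullet> z = p \<bullet> z" if "A *v z = 0" for z
      using null_proj_inner[OF that, of p] null_proj_inner[OF that, of "B *v w"] 2 by simp
  qed
qed

text \<open>The optimality condition is tested with \<open>w\<close> itself. The estimate serves for
  the true step, for its response to the noise and for the adjoint solutions.\<close>

lemma reduced_solution_coercive:
  assumes "\<And>z. A *v z = 0 \<Longrightarrow> z \<bullet> (B *v z) \<ge> \<zeta> * (norm z)\<^sup>2" "0 < \<zeta>" "reduced_solution A B p w"
  shows "\<zeta> * norm w \<le> norm p"
proof -
  have w: "A *v w = 0" "(B *v w) \<bullet> w = p \<bullet> w"
    using assms(3) by (auto simp: reduced_solution_def)
  have "\<zeta> * (norm w)\<^sup>2 \<le> p \<bullet> w"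
    using assms(1)[OF w(1)] w(2) by (simp add: inner_commute)
  also have "\<dots> \<le> norm p * norm w"
    by (rule norm_cauchy_schwarz)
  finally have "\<zeta> * norm w * norm w \<le> norm p * norm w"
    by (simp add: power2_eq_square)
  then show ?thesis
    by (cases "w = 0") simp_all
qed

lemma reduced_matrix_inj:
  assumes "\<And>z. A *v z = 0 \<Longrightarrow> z \<bullet> (B *v z) \<ge> \<zeta> * (norm z)\<^sup>2" "0 < \<zeta>" "reduced_matrix A B *v w = 0"
  shows "w = 0"
proof -
  have "reduced_solution A B 0 w"
    using assms linear_0[OF linear_null_proj] by (simp add: reduced_solution_iff)
  from reduced_solution_coercive[OF assms(1,2) this] show ?thesis
    using assms(2) by (simp add: mult_le_0_iff)
qed

lemma reduced_solution_exists:
  assumes "\<And>z. A *v z = 0 \<Longrightarrow> z \<bullet> (B *v z) \<ge> \<zeta> * (norm z)\<^sup>2" "0 < \<zeta>"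
  shows "\<exists>w. reduced_solution A B p w"
proof -
  have "\<exists>w. reduced_matrix A B *v w = null_proj A p"
    by (rule injective_matrix(2)) (rule reduced_matrix_inj[OF assms])
  then show ?thesis
    by (simp add: reduced_solution_iff)
qed

lemma borel_measurable_reduced_solution:
  fixes A :: "'a \<Rightarrow> real^'n^'m"
  assumes "A \<in> borel_measurable N" "B \<in> borel_measurable N" "p \<in> borel_measurable N" "0 < \<zeta>"
    and "\<And>s z. s \<in> space N \<Longrightarrow> A s *v z = 0 \<Longrightarrow> z \<bullet> (B s *v z) \<ge> \<zeta> * (norm z)\<^sup>2"
    and "\<And>s. s \<in> space N \<Longrightarrow> reduced_solution (A s) (B s) (p s) (w s)"
  shows "w \<in> borel_measurable N"
proof (rule borel_measurable_linear_system)
  show "(\<lambda>s. reduced_matrix (A s) (B s)) \<in> borel_measurable N"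
    unfolding reduced_matrix_def
    by (intro borel_measurable_add borel_measurable_diff borel_measurable_const
        borel_measurable_matrix_mult borel_measurable_matrix_null_proj assms)
  show "(\<lambda>s. null_proj (A s) (p s)) \<in> borel_measurable N"
    by (intro borel_measurable_null_proj assms)
qed (use assms reduced_matrix_inj reduced_solution_iff in blast)+

lemma reduced_solution_diff:
  assumes "reduced_solution A B p w" "reduced_solution A B p' w'"
  shows "reduced_solution A B (p - p') (w - w')"
  unfolding reduced_solution_iff matrix_vector_mult_diff_distrib linear_diff[OF linear_null_proj]
  using assms[unfolded reduced_solution_iff] by simp

text \<open>For symmetric \<open>B\<close> the map from \<open>p\<close> to \<open>w\<close> is
  self-adjoint: both sides equal \<open>(B *v w) \<bullet> w'\<close>.\<close>

lemma reduced_solution_swap: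
  assumes "transpose B = B" "reduced_solution A B p w" "reduced_solution A B p' w'"
  shows "p \<bullet> w' = w \<bullet> p'"
proof -
  have "p \<bullet> w' = (B *v w) \<bullet> w'"
    using assms by (simp add: reduced_solution_def)
  also have "\<dots> = (B *v w') \<bullet> w"
    by (simp only: symmetric_inner[OF assms(1)] inner_commute[of w])
  also have "\<dots> = w \<bullet> p'"
    using assms by (simp add: reduced_solution_def inner_commute)
  finally show ?thesis .
qed

text \<open>Along each line \<open>u + t *\<^sub>R z\<close> in the null space the objective is a
  quadratic in t that is minimal at 0, so its linear coefficient vanishes.\<close>

lemma tangential_step_reduced_solution:
  assumes sym: "transpose B = B" and u: "tangential_step q B A v u"
  shows "reduced_solution A B (- (q + B *v v)) u"
proof -
  define b where "b = q + B *v v"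
  have Au: "A *v u = 0"
    and min: "\<And>y. A *v y = 0 \<Longrightarrow> b \<bullet> u + 1/2 * (u \<bullet> (B *v u)) \<le> b \<bullet> y + 1/2 * (y \<bullet> (B *v y))"
    using u by (auto simp: tangential_step_def is_arg_min_def b_def not_less)
  have "(b + B *v u) \<bullet> z = 0" if z: "A *v z = 0" for z
  proof -
    define C where "C = z \<bullet> (B *v z)"
    define m where "m = (b + B *v u) \<bullet> z"
    have quad: "0 \<le> t * m + t\<^sup>2 / 2 * C" for t
    proof -
      have "A *v (u + t *\<^sub>R z) = 0"
        using Au z by (simp add: matrix_vector_right_distrib matrix_vector_mult_scaleR)
      from min[OF this] show ?thesis
        using symmetric_inner[OF sym, of u z] inner_commute[of z "B *v u"]
        by (simp add: m_def C_def matrix_vector_right_distrib matrix_vector_mult_scaleR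
            inner_add_left inner_add_right power2_eq_square algebra_simps)
    qed
    \<comment> \<open>A strictly positive bound for the curvature \<open>C\<close>. The trial value
      \<open>- m / D\<close> changes the objective by at most \<open>- m\<^sup>2 / (2 * D)\<close>,
      which contradicts minimality unless \<open>m = 0\<close>.\<close>
    define D where "D = \<bar>C\<bar> + 1"
    have D: "D > 0" "C \<le> D" by (auto simp: D_def)
    have "0 \<le> - m / D * m + (m / D)\<^sup>2 / 2 * C"
      using quad[of "- m / D"] by simp
    also have "\<dots> \<le> - m / D * m + (m / D)\<^sup>2 / 2 * D"
      using D by (intro add_left_mono mult_left_mono) auto
    also have "\<dots> = - m\<^sup>2 / (2 * D)"
      using D by (simp add: power2_eq_square field_simps)
    finally have "m\<^sup>2 / (2 * D) \<le> 0" by simp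
    then have "m = 0"
      using D by (simp add: divide_le_0_iff)
    then show ?thesis
      by (simp add: m_def)
  qed
  then show ?thesis
    using Au unfolding reduced_solution_def b_def[symmetric]
    by (simp add: inner_add_left add_eq_0_iff)
qed

subsection \<open>The decrease of the merit function\<close>

text \<open>Common core of the two Taylor estimates below: subtracting the linear and the quadratic
  term leaves a nonincreasing function.\<close>

lemma quadratic_bound_unit_interval:
  fixes \<phi> :: "real \<Rightarrow> real"
  assumes "\<And>t. 0 \<le> t \<Longrightarrow> t \<le> 1 \<Longrightarrow> (\<phi> has_real_derivative \<phi>' t) (at t)"
    and "\<And>t. 0 \<le> t \<Longrightarrow> t \<le> 1 \<Longrightarrow> \<phi>' t - \<phi>' 0 \<le> C * t"
  shows "\<phi> 1 \<le> \<phi> 0 + \<phi>' 0 + C / 2"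
proof -
  let ?h = "\<lambda>t. \<phi> t - \<phi>' 0 * t - C * t\<^sup>2 / 2"
  have "?h 1 \<le> ?h 0"
  proof (rule DERIV_nonpos_imp_nonincreasing[where f = ?h and a = 0 and b = 1])
    fix t :: real assume t: "0 \<le> t" "t \<le> 1"
    have "(?h has_real_derivative \<phi>' t - \<phi>' 0 - C * t) (at t)"
      by (auto intro!: derivative_eq_intros assms(1) t)
    moreover have "\<phi>' t - \<phi>' 0 - C * t \<le> 0"
      using assms(2)[OF t] by simp
    ultimately show "\<exists>y. (?h has_real_derivative y) (at t) \<and> y \<le> 0" by blast
  qed simp
  then show ?thesis by simp
qed

lemma convex_segment_mem:
  assumes "convex X" "y \<in> X" "z \<in> X" "0 \<le> t" "t \<le> 1"
  shows "y + t *\<^sub>R (z - y) \<in> X"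
proof -
  have "(1 - t) *\<^sub>R y + t *\<^sub>R z \<in> X"
    using assms by (simp add: convexD_alt)
  also have "(1 - t) *\<^sub>R y + t *\<^sub>R z = y + t *\<^sub>R (z - y)"
    by (simp add: algebra_simps)
  finally show ?thesis .
qed

lemma lipschitz_gradient_upper_bound:
  fixes f :: "'a::real_inner \<Rightarrow> real"
  assumes "convex X" "y \<in> X" "z \<in> X"
    and f: "\<And>w. w \<in> X \<Longrightarrow> GDERIV f w :> gradf w"
    and L: "L-lipschitz_on X gradf"
  shows "f z \<le> f y + gradf y \<bullet> (z - y) + L / 2 * (norm (z - y))\<^sup>2"
proof -
  let ?p = "\<lambda>t. y + t *\<^sub>R (z - y)"
  let ?\<phi> = "\<lambda>t. f (?p t)" and ?\<phi>' = "\<lambda>t. gradf (?p t) \<bullet> (z - y)"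
  have p: "?p t \<in> X" if "0 \<le> t" "t \<le> 1" for t
    using convex_segment_mem[OF assms(1-3) that] .
  have "?\<phi> 1 \<le> ?\<phi> 0 + ?\<phi>' 0 + (L * (norm (z - y))\<^sup>2) / 2"
  proof (rule quadratic_bound_unit_interval)
    fix t :: real assume t: "0 \<le> t" "t \<le> 1"
    have "(f has_derivative (\<lambda>h. h \<bullet> gradf (?p t))) (at (?p t))"
      using f[OF p[OF t]] by (simp add: gderiv_def)
    moreover have "(?p has_derivative (\<lambda>h. h *\<^sub>R (z - y))) (at t)"
      by (auto intro!: derivative_eq_intros)
    ultimately have "(?\<phi> has_derivative (\<lambda>h. (h *\<^sub>R (z - y)) \<bullet> gradf (?p t))) (at t)"
      by (rule has_derivative_compose[rotated])
    then show "(?\<phi> has_real_derivative ?\<phi>' t) (at t)"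
      by (simp add: has_field_derivative_def inner_commute mult.commute[of _ "_ \<bullet> _"])
    have "dist (gradf (?p t)) (gradf y) \<le> L * dist (?p t) y"
      by (rule lipschitz_onD[OF L p[OF t] assms(2)])
    then have *: "norm (gradf (?p t) - gradf y) \<le> L * (t * norm (z - y))"
      using t by (simp add: dist_norm)
    have "?\<phi>' t - ?\<phi>' 0 = (gradf (?p t) - gradf y) \<bullet> (z - y)"
      by (simp add: inner_diff_left)
    also have "\<dots> \<le> norm (gradf (?p t) - gradf y) * norm (z - y)"
      by (rule norm_cauchy_schwarz)
    also have "\<dots> \<le> L * (t * norm (z - y)) * norm (z - y)"
      by (intro mult_right_mono *) simp
    also have "\<dots> = L * (norm (z - y))\<^sup>2 * t"
      by (simp add: power2_eq_square)
    finally show "?\<phi>' t - ?\<phi>' 0 \<le> L * (norm (z - y))\<^sup>2 * t" .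
  qed
  then show ?thesis by simp
qed

lemma op_norm_bound:
  fixes A :: "real^'n^'m"
  assumes "op_norm A \<le> k"
  shows "norm (A *v z) \<le> k * norm z"
proof -
  have "norm (A *v z) \<le> op_norm A * norm z"
    by (rule onorm) simp
  also have "\<dots> \<le> k * norm z"
    by (intro mult_right_mono assms) simp
  finally show ?thesis .
qed

text \<open>Obtained by pairing \<open>transpose A *v z\<close> with itself, moving one factor
  across to \<open>A\<close> and cancelling a norm.\<close>

lemma op_norm_transpose_bound:
  fixes A :: "real^'n^'m"
  assumes "op_norm A \<le> k"
  shows "norm (transpose A *v z) \<le> k * norm z"
proof -
  let ?w = "transpose A *v z"
  have "norm ?w * norm ?w = z \<bullet> (A *v ?w)"
    by (simp flip: power2_eq_square add: power2_norm_eq_inner transpose_inner)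
  also have "\<dots> \<le> norm z * norm (A *v ?w)"
    by (rule norm_cauchy_schwarz)
  also have "\<dots> \<le> norm z * (k * norm ?w)"
    by (intro mult_left_mono op_norm_bound assms) simp
  finally have "norm ?w * norm ?w \<le> (k * norm z) * norm ?w"
    by (simp add: ac_simps)
  moreover have "0 \<le> k"
    using onorm_pos_le[OF matrix_vector_mul_bounded_linear[of A]] assms by linarith
  ultimately show ?thesis
    by (cases "?w = 0") simp_all
qed

text \<open>The one-dimensional estimate is scalar, so \<open>c\<close> is paired with the error
  vector \<open>e\<close> itself; this bounds \<open>e \<bullet> e\<close>, and one factor
  \<open>norm e\<close> is cancelled.\<close>

lemma lipschitz_jacobian_error_bound:
  fixes c :: "real^'n \<Rightarrow> real^'m"
  assumes "convex X" "y \<in> X" "z \<in> X"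
    and c: "\<And>w. w \<in> X \<Longrightarrow> (c has_derivative (*v) (J w)) (at w)"
    and J: "\<And>w. w \<in> X \<Longrightarrow> op_norm (J w - J y) \<le> \<Gamma> * norm (w - y)"
  shows "norm (c z - c y - J y *v (z - y)) \<le> \<Gamma> / 2 * (norm (z - y))\<^sup>2"
proof -
  let ?p = "\<lambda>t. y + t *\<^sub>R (z - y)"
  define e where "e = c z - c y - J y *v (z - y)"
  let ?\<phi> = "\<lambda>t. e \<bullet> c (?p t)" and ?\<phi>' = "\<lambda>t. e \<bullet> (J (?p t) *v (z - y))"
  have p: "?p t \<in> X" if "0 \<le> t" "t \<le> 1" for t
    using convex_segment_mem[OF assms(1-3) that] .
  have "?\<phi> 1 \<le> ?\<phi> 0 + ?\<phi>' 0 + (norm e * \<Gamma> * (norm (z - y))\<^sup>2) / 2"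
  proof (rule quadratic_bound_unit_interval)
    fix t :: real assume t: "0 \<le> t" "t \<le> 1"
    have "(?p has_derivative (\<lambda>h. h *\<^sub>R (z - y))) (at t)"
      by (auto intro!: derivative_eq_intros)
    then have "((\<lambda>t. c (?p t)) has_derivative (\<lambda>h. J (?p t) *v (h *\<^sub>R (z - y)))) (at t)"
      using c[OF p[OF t]] by (rule has_derivative_compose)
    then have "(?\<phi> has_derivative (\<lambda>h. e \<bullet> (J (?p t) *v (h *\<^sub>R (z - y))))) (at t)"
      by (rule has_derivative_inner_right)
    then show "(?\<phi> has_real_derivative ?\<phi>' t) (at t)"
      by (simp add: has_field_derivative_def matrix_vector_mult_scaleR mult.commute[of _ "_ \<bullet> _"])
    have *: "norm ((J (?p t) - J y) *v (z - y)) \<le> \<Gamma> * norm (?p t - y) * norm (z - y)"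
      by (intro op_norm_bound J p t)
    have "?\<phi>' t - ?\<phi>' 0 = e \<bullet> ((J (?p t) - J y) *v (z - y))"
      by (simp add: inner_diff_right matrix_vector_mult_diff_rdistrib)
    also have "\<dots> \<le> norm e * norm ((J (?p t) - J y) *v (z - y))"
      by (rule norm_cauchy_schwarz)
    also have "\<dots> \<le> norm e * (\<Gamma> * norm (?p t - y) * norm (z - y))"
      by (intro mult_left_mono *) simp
    also have "\<dots> = norm e * \<Gamma> * (norm (z - y))\<^sup>2 * t"
      using t by (simp add: power2_eq_square)
    finally show "?\<phi>' t - ?\<phi>' 0 \<le> norm e * \<Gamma> * (norm (z - y))\<^sup>2 * t" .
  qed
  then have "e \<bullet> c z - e \<bullet> c y - e \<bullet> (J y *v (z - y)) \<le> norm e * (\<Gamma> * (norm (z - y))\<^sup>2) / 2"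
    by simp
  then have "e \<bullet> e \<le> norm e * (\<Gamma> * (norm (z - y))\<^sup>2) / 2"
    by (metis e_def inner_diff_right)
  then have "norm e * norm e \<le> norm e * (\<Gamma> / 2 * (norm (z - y))\<^sup>2)"
    by (simp flip: power2_eq_square add: power2_norm_eq_inner)
  moreover have "0 \<le> \<Gamma> / 2 * (norm (z - y))\<^sup>2"
    using order_trans[OF onorm_pos_le[OF matrix_vector_mul_bounded_linear] J[OF assms(3)]]
    by (cases "z = y") (auto simp: zero_le_mult_iff)
  ultimately have "norm e \<le> \<Gamma> / 2 * (norm (z - y))\<^sup>2"
    by (cases "e = 0") simp_all
  then show ?thesis
    by (simp add: e_def)
qed

text \<open>For \<open>0 \<le> a \<le> 1\<close>, the linearized constraint value at step
  \<open>a\<close> is a convex combination of those at steps 0 and 1. Hence a fraction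
  \<open>a\<close> of the full decrease is realized, and the Taylor errors form the quadratic
  term.\<close>

lemma merit_upper_bound:
  fixes c :: "real^'n \<Rightarrow> real^'m"
  assumes X: "convex X" "y \<in> X" "y + a *\<^sub>R d \<in> X"
    and f: "\<And>w. w \<in> X \<Longrightarrow> GDERIV f w :> gradf w" "L-lipschitz_on X gradf"
    and c: "\<And>w. w \<in> X \<Longrightarrow> (c has_derivative (*v) (J w)) (at w)"
    and J: "\<And>w. w \<in> X \<Longrightarrow> op_norm (J w - J y) \<le> \<Gamma> * norm (w - y)"
    and a: "0 \<le> a" "a \<le> 1" and \<tau>: "0 \<le> \<tau>"
  shows "\<tau> * f (y + a *\<^sub>R d) + norm (c (y + a *\<^sub>R d)) - (\<tau> * f y + norm (c y))
    \<le> a * (\<tau> * (gradf y \<bullet> d) - (norm (c y) - norm (c y + J y *v d)))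
      + (\<tau> * L + \<Gamma>) / 2 * (a\<^sup>2 * (norm d)\<^sup>2)"
proof -
  let ?z = "y + a *\<^sub>R d"
  have nz: "(norm (?z - y))\<^sup>2 = a\<^sup>2 * (norm d)\<^sup>2"
    by (simp add: power_mult_distrib)
  have "f ?z \<le> f y + gradf y \<bullet> (?z - y) + L / 2 * (norm (?z - y))\<^sup>2"
    by (rule lipschitz_gradient_upper_bound[OF X f])
  then have "f ?z \<le> f y + a * (gradf y \<bullet> d) + L / 2 * (a\<^sup>2 * (norm d)\<^sup>2)"
    unfolding nz by simp
  from mult_left_mono[OF this \<tau>]
  have 1: "\<tau> * f ?z \<le> \<tau> * f y + a * (\<tau> * (gradf y \<bullet> d)) + \<tau> * L / 2 * (a\<^sup>2 * (norm d)\<^sup>2)"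
    by (simp add: algebra_simps)
  have "norm (c ?z - c y - J y *v (?z - y)) \<le> \<Gamma> / 2 * (norm (?z - y))\<^sup>2"
    by (rule lipschitz_jacobian_error_bound[OF X c J])
  then have 2: "norm (c ?z - c y - a *\<^sub>R (J y *v d)) \<le> \<Gamma> / 2 * (a\<^sup>2 * (norm d)\<^sup>2)"
    unfolding nz by (simp add: matrix_vector_mult_scaleR)
  have "norm (c y + a *\<^sub>R (J y *v d)) = norm ((1 - a) *\<^sub>R c y + a *\<^sub>R (c y + J y *v d))"
    by (simp add: algebra_simps)
  also have "\<dots> \<le> norm ((1 - a) *\<^sub>R c y) + norm (a *\<^sub>R (c y + J y *v d))"
    by (rule norm_triangle_ineq)
  also have "\<dots> = norm (c y) - a * (norm (c y) - norm (c y + J y *v d))"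
    unfolding norm_scaleR using a by (simp add: algebra_simps)
  finally have 3: "norm (c y + a *\<^sub>R (J y *v d)) \<le> norm (c y) - a * (norm (c y) - norm (c y + J y *v d))" .
  have "norm (c ?z) \<le> norm (c ?z - c y - a *\<^sub>R (J y *v d)) + norm (c y + a *\<^sub>R (J y *v d))"
    using norm_triangle_ineq[of "c ?z - c y - a *\<^sub>R (J y *v d)" "c y + a *\<^sub>R (J y *v d)"] by simp
  with 1 2 3 show ?thesis
    by (simp add: algebra_simps add_divide_distrib)
qed

text \<open>The scalars stand for: \<open>t\<close> the true directional derivative,
  \<open>m\<close> and \<open>n\<close> the derivative along the step error and the norm of that
  error, \<open>q\<close> the curvature, \<Delta> the linearized decrease, \<open>U\<close> and
  \<open>V\<close> the squared norms of \<open>u\<close> and \<open>v\<close>, \<open>N\<close> that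
  of \<open>transpose J *v c\<close>, \<open>R\<close> a bound for \<open>N\<close>. Half of
  \<open>\<sigma> * \<Delta>\<close> pays for the quadratic term of the normal step; the other half
  survives.\<close>

lemma decrease_algebra:
  fixes S :: real
  assumes a: "\<nu> \<le> a" "a \<le> \<nu> + \<theta> * \<beta>" "a \<le> 1"
    and pos: "0 < \<nu>" "0 < \<beta>" "0 < \<tau>" "0 < \<sigma>" "0 < \<kappa>\<^sub>v" "0 < \<kappa>\<^sub>c" "0 < \<theta>" "0 \<le> S" "0 \<le> n" "0 \<le> q"
    and merit: "\<tau> * (t + \<beta> * q) \<le> (1 - \<sigma>) * \<Delta>"
    and m: "\<bar>m\<bar> \<le> \<kappa>\<^sub>g * n"
    and V: "V \<le> \<omega>\<^sup>2 * N" "\<kappa>\<^sub>v * N \<le> \<kappa>\<^sub>c * \<Delta>" "N \<le> R" "0 \<le> N" "0 \<le> V" "0 \<le> U"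
    and \<nu>: "2 * S * \<omega>\<^sup>2 * \<nu> * \<kappa>\<^sub>c \<le> \<sigma> * \<kappa>\<^sub>v"
  shows "a * (\<tau> * (t + \<beta> * m) - \<Delta>) + S / 2 * (a\<^sup>2 * (\<beta>\<^sup>2 * U + V))
    \<le> - \<nu> * (\<sigma> / 2 * \<Delta> + \<tau> * \<beta> * q) + \<nu> * \<tau> * \<beta> * m + \<theta> * \<beta>\<^sup>2 * \<tau> * \<kappa>\<^sub>g * n
      + S / 2 * (\<beta>\<^sup>2 * U) + \<beta>\<^sup>2 * (\<theta>\<^sup>2 * S * \<omega>\<^sup>2 * R)"
proof -
  have "0 \<le> \<kappa>\<^sub>v * N"
    using pos V by simp
  then have "0 \<le> \<kappa>\<^sub>c * \<Delta>"
    using V by linarith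
  then have \<Delta>: "0 \<le> \<Delta>"
    using pos by (simp add: zero_le_mult_iff)
  have "\<tau> * t - \<Delta> \<le> - (\<sigma> * \<Delta> + \<tau> * \<beta> * q)"
    using merit by (simp add: algebra_simps)
  then have "a * (\<tau> * t - \<Delta>) \<le> a * (- (\<sigma> * \<Delta> + \<tau> * \<beta> * q))"
    using a pos by (intro mult_left_mono) auto
  also have "\<dots> \<le> - \<nu> * (\<sigma> * \<Delta> + \<tau> * \<beta> * q)"
    unfolding mult_minus_left mult_minus_right neg_le_iff_le
    using a pos \<Delta> by (intro mult_right_mono) auto
  finally have 1: "a * (\<tau> * t - \<Delta>) \<le> - \<nu> * (\<sigma> * \<Delta> + \<tau> * \<beta> * q)" .
  \<comment> \<open>The part \<open>\<nu> * m\<close> stays exact, because it has mean zero later.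
    The excess \<open>a - \<nu>\<close> may be correlated with \<open>m\<close>, so it is estimated
    in absolute value.\<close>
  have "(a - \<nu>) * m \<le> (a - \<nu>) * \<bar>m\<bar>"
    using a by (intro mult_left_mono) auto
  also have "\<dots> \<le> (\<theta> * \<beta>) * (\<kappa>\<^sub>g * n)"
    using a pos m by (intro mult_mono) auto
  finally have "(a - \<nu>) * m * (\<tau> * \<beta>) \<le> (\<theta> * \<beta>) * (\<kappa>\<^sub>g * n) * (\<tau> * \<beta>)"
    using pos by (intro mult_right_mono) auto
  then have 2: "a * (\<tau> * (\<beta> * m)) \<le> \<nu> * \<tau> * \<beta> * m + \<theta> * \<beta>\<^sup>2 * \<tau> * \<kappa>\<^sub>g * n"
    by (simp add: algebra_simps power2_eq_square)
  have "a\<^sup>2 \<le> 1\<^sup>2"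
    using a pos by (intro power_mono) auto
  then have 3: "a\<^sup>2 * (\<beta>\<^sup>2 * U) \<le> \<beta>\<^sup>2 * U"
    using V by (intro mult_left_le_one_le) auto
  \<comment> \<open>The square is split because its parts have different fates: the \<nu> part is
    absorbed into the decrease, and the \<beta> part becomes the last summand of
    \<open>\<kappa>\<^sub>1\<close>.\<close>
  have "a\<^sup>2 \<le> (\<nu> + \<theta> * \<beta>)\<^sup>2"
    using a pos by (intro power_mono) auto
  also have "\<dots> \<le> 2 * \<nu>\<^sup>2 + 2 * \<theta>\<^sup>2 * \<beta>\<^sup>2"
    using zero_le_power2[of "\<nu> - \<theta> * \<beta>"] by (simp add: power2_eq_square algebra_simps)
  finally have "S / 2 * (a\<^sup>2 * V) \<le> S / 2 * ((2 * \<nu>\<^sup>2 + 2 * \<theta>\<^sup>2 * \<beta>\<^sup>2) * (\<omega>\<^sup>2 * N))"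
    using V pos by (intro mult_left_mono mult_mono) auto
  then have 4: "S / 2 * (a\<^sup>2 * V) \<le> S * \<nu>\<^sup>2 * \<omega>\<^sup>2 * N + \<beta>\<^sup>2 * (\<theta>\<^sup>2 * S * \<omega>\<^sup>2 * N)"
    by (simp add: algebra_simps)
  have 5: "\<beta>\<^sup>2 * (\<theta>\<^sup>2 * S * \<omega>\<^sup>2 * N) \<le> \<beta>\<^sup>2 * (\<theta>\<^sup>2 * S * \<omega>\<^sup>2 * R)"
    using V pos by (intro mult_left_mono) auto
  \<comment> \<open>Here the upper bound on \<nu> acts: it is calibrated so that the absorbed part
    costs at most half of \<open>\<nu> * \<sigma> * \<Delta>\<close>.\<close>
  have "\<kappa>\<^sub>c * (2 * S * \<omega>\<^sup>2 * \<nu> * N) \<le> \<sigma> * (\<kappa>\<^sub>v * N)"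
    using mult_right_mono[OF \<nu> V(4)] by (simp add: ac_simps)
  also have "\<dots> \<le> \<sigma> * (\<kappa>\<^sub>c * \<Delta>)"
    using V pos by (intro mult_left_mono) auto
  also have "\<dots> = \<kappa>\<^sub>c * (\<sigma> * \<Delta>)"
    by simp
  finally have "2 * S * \<omega>\<^sup>2 * \<nu> * N \<le> \<sigma> * \<Delta>"
    using pos by (simp only: mult_le_cancel_left_pos)
  then have "\<nu> * (2 * S * \<omega>\<^sup>2 * \<nu> * N) \<le> \<nu> * (\<sigma> * \<Delta>)"
    using pos by (intro mult_left_mono) auto
  then have 6: "S * \<nu>\<^sup>2 * \<omega>\<^sup>2 * N \<le> \<nu> * (\<sigma> / 2 * \<Delta>)"
    by (simp add: power2_eq_square algebra_simps)
  have 7: "S / 2 * (a\<^sup>2 * (\<beta>\<^sup>2 * U)) \<le> S / 2 * (\<beta>\<^sup>2 * U)"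
    using 3 pos by (intro mult_left_mono) auto
  have "a * (\<tau> * (t + \<beta> * m) - \<Delta>) + S / 2 * (a\<^sup>2 * (\<beta>\<^sup>2 * U + V))
    = a * (\<tau> * t - \<Delta>) + a * (\<tau> * (\<beta> * m)) + S / 2 * (a\<^sup>2 * (\<beta>\<^sup>2 * U)) + S / 2 * (a\<^sup>2 * V)"
    by (simp add: algebra_simps)
  also have "\<dots> \<le> - \<nu> * (\<sigma> * \<Delta> + \<tau> * \<beta> * q) + (\<nu> * \<tau> * \<beta> * m + \<theta> * \<beta>\<^sup>2 * \<tau> * \<kappa>\<^sub>g * n)
      + S / 2 * (\<beta>\<^sup>2 * U) + (\<nu> * (\<sigma> / 2 * \<Delta>) + \<beta>\<^sup>2 * (\<theta>\<^sup>2 * S * \<omega>\<^sup>2 * R))"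
    using 1 2 4 5 6 7 by (intro add_mono) auto
  also have "\<dots> = - \<nu> * (\<sigma> / 2 * \<Delta> + \<tau> * \<beta> * q) + \<nu> * \<tau> * \<beta> * m + \<theta> * \<beta>\<^sup>2 * \<tau> * \<kappa>\<^sub>g * n
      + S / 2 * (\<beta>\<^sup>2 * U) + \<beta>\<^sup>2 * (\<theta>\<^sup>2 * S * \<omega>\<^sup>2 * R)"
    by (simp add: algebra_simps)
  finally show ?thesis .
qed

section \<open>Bounds for the exact steps and the one-step estimate\<close>

lemma norm_pythagoras:
  fixes a b :: "'a::real_inner"
  assumes "a \<bullet> b = 0"
  shows "(norm (a + b))\<^sup>2 = (norm a)\<^sup>2 + (norm b)\<^sup>2"
  using assms by (simp add: power2_norm_eq_inner inner_add_left inner_add_right inner_commute)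

lemma op_norm_nonneg:
  fixes A :: "real^'n^'m"
  shows "op_norm A \<le> k \<Longrightarrow> 0 \<le> k"
  using onorm_pos_le[OF matrix_vector_mul_bounded_linear[of A]] by linarith

text \<open>The constant \<open>\<kappa>\<^sub>u\<close> is the coercivity bound for the right-hand
  side \<open>p + B *v v\<close>, with the normal step bounded by
  \<open>\<omega> * \<kappa>\<^sub>J * \<kappa>\<^sub>c\<close>.\<close>

lemma tangential_solution_bounds:
  fixes B :: "real^'n^'n" and A :: "real^'n^'m"
  assumes hess: "hessian_assumption A B \<kappa>\<^sub>H \<zeta>" and "0 < \<zeta>"
    and u: "reduced_solution A B (- (p + B *v v)) u"
    and v: "norm v \<le> \<omega> * norm (transpose A *v cy)" and "0 < \<omega>"
    and bounds: "norm p \<le> \<kappa>\<^sub>g" "norm cy \<le> \<kappa>\<^sub>c" "op_norm A \<le> \<kappa>\<^sub>J"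
    and \<kappa>\<^sub>u: "\<kappa>\<^sub>u = inverse \<zeta> * (\<kappa>\<^sub>g + \<kappa>\<^sub>H * \<omega> * \<kappa>\<^sub>J * \<kappa>\<^sub>c)"
  shows "norm u \<le> \<kappa>\<^sub>u" "u \<bullet> (B *v u) \<le> \<kappa>\<^sub>H * \<kappa>\<^sub>u\<^sup>2" "\<zeta> * (norm u)\<^sup>2 \<le> u \<bullet> (B *v u)"
    "norm v \<le> \<omega> * (\<kappa>\<^sub>J * \<kappa>\<^sub>c)"
proof -
  have B: "op_norm B \<le> \<kappa>\<^sub>H"
    and coercive: "\<And>z. A *v z = 0 \<Longrightarrow> z \<bullet> (B *v z) \<ge> \<zeta> * (norm z)\<^sup>2"
    using hess by (auto simp: hessian_assumption_def)
  note nonneg = op_norm_nonneg[OF B] op_norm_nonneg[OF bounds(3)]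
  have "norm (transpose A *v cy) \<le> \<kappa>\<^sub>J * norm cy"
    by (rule op_norm_transpose_bound[OF bounds(3)])
  also have "\<dots> \<le> \<kappa>\<^sub>J * \<kappa>\<^sub>c"
    using nonneg bounds by (intro mult_left_mono)
  finally show nv: "norm v \<le> \<omega> * (\<kappa>\<^sub>J * \<kappa>\<^sub>c)"
    using v \<open>0 < \<omega>\<close> by (meson mult_left_mono less_imp_le order_trans)
  have "\<zeta> * norm u \<le> norm (p + B *v v)"
    using reduced_solution_coercive[OF coercive \<open>0 < \<zeta>\<close> u] by (simp only: norm_minus_cancel)
  also have "\<dots> \<le> norm p + norm (B *v v)"
    by (rule norm_triangle_ineq)
  also have "\<dots> \<le> \<kappa>\<^sub>g + \<kappa>\<^sub>H * norm v"
    by (intro add_mono bounds op_norm_bound B)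
  also have "\<dots> \<le> \<kappa>\<^sub>g + \<kappa>\<^sub>H * (\<omega> * (\<kappa>\<^sub>J * \<kappa>\<^sub>c))"
    using nonneg nv by (intro add_left_mono mult_left_mono)
  finally show nu: "norm u \<le> \<kappa>\<^sub>u"
    using \<open>0 < \<zeta>\<close> by (simp add: \<kappa>\<^sub>u field_simps)
  have "u \<bullet> (B *v u) \<le> norm u * norm (B *v u)"
    by (rule norm_cauchy_schwarz)
  also have "\<dots> \<le> norm u * (\<kappa>\<^sub>H * norm u)"
    by (intro mult_left_mono op_norm_bound B) simp
  also have "\<dots> = \<kappa>\<^sub>H * (norm u)\<^sup>2"
    by (simp add: power2_eq_square)
  also have "\<dots> \<le> \<kappa>\<^sub>H * \<kappa>\<^sub>u\<^sup>2"
    using nonneg nu by (intro mult_left_mono power_mono) auto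
  finally show "u \<bullet> (B *v u) \<le> \<kappa>\<^sub>H * \<kappa>\<^sub>u\<^sup>2" .
  show "\<zeta> * (norm u)\<^sup>2 \<le> u \<bullet> (B *v u)"
    using u by (intro coercive) (simp add: reduced_solution_def)
qed

lemma normal_step_decrease:
  fixes A :: "real^'n^'m"
  assumes "\<kappa>\<^sub>v * (norm (transpose A *v cy))\<^sup>2 \<le> norm cy * (norm cy - norm (cy + A *v v))" "0 < \<kappa>\<^sub>v"
    and "norm v \<le> \<omega> * norm (transpose A *v cy)" "norm cy \<le> \<kappa>\<^sub>c"
  shows "0 \<le> norm cy - norm (cy + A *v v)"
    and "\<kappa>\<^sub>v * (norm (transpose A *v cy))\<^sup>2 \<le> \<kappa>\<^sub>c * (norm cy - norm (cy + A *v v))"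
proof -
  show nonneg: "0 \<le> norm cy - norm (cy + A *v v)"
  proof (cases "cy = 0")
    \<comment> \<open>At a feasible point the product inequality carries no information about the
      decrease; the bound on \<open>v\<close> then forces \<open>v = 0\<close>.\<close>
    case True
    then have "v = 0"
      using assms(3) by simp
    then show ?thesis by simp
  next
    case False
    have "0 \<le> norm cy * (norm cy - norm (cy + A *v v))"
      by (rule order_trans[OF _ assms(1)]) (use assms(2) in simp)
    then show ?thesis
      using False by (simp add: zero_le_mult_iff)
  qed
  show "\<kappa>\<^sub>v * (norm (transpose A *v cy))\<^sup>2 \<le> \<kappa>\<^sub>c * (norm cy - norm (cy + A *v v))"
    by (rule order_trans[OF assms(1) mult_right_mono[OF assms(4) nonneg]])
qed

text \<open>
  The error \<open>u - u\<^sup>t\<^sup>r\<^sup>u\<^sup>e\<close> depends linearly on the noise \<open>g - \<nabla>f\<close>. Testing it against \<open>\<nabla>f\<close> and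
  \<open>u\<^sup>t\<^sup>r\<^sup>u\<^sup>e\<close> amounts to testing the noise itself against the solutions \<open>w1\<close> and \<open>w2\<close> of the adjoint
  problems, which do not depend on \<open>g\<close>; these terms have mean zero.
\<close>

lemma merit_decrease:
  fixes c :: "real^'n \<Rightarrow> real^'m"
  assumes X: "convex X" "y \<in> X" "y + a *\<^sub>R (\<beta> *\<^sub>R u + v) \<in> X"
    and f: "\<And>w. w \<in> X \<Longrightarrow> GDERIV f w :> gradf w" "L-lipschitz_on X gradf"
    and c: "\<And>w. w \<in> X \<Longrightarrow> (c has_derivative (*v) (J w)) (at w)"
    and J: "\<And>w. w \<in> X \<Longrightarrow> op_norm (J w - J y) \<le> \<Gamma> * norm (w - y)"
    and bounds: "norm (gradf y) \<le> \<kappa>\<^sub>g" "norm (c y) \<le> \<kappa>\<^sub>c" "op_norm (J y) \<le> \<kappa>\<^sub>J"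
    and hess: "hessian_assumption (J y) B \<kappa>\<^sub>H \<zeta>"
    and pos: "0 < \<zeta>" "0 < \<nu>" "0 < \<beta>" "0 < \<tau>" "0 < \<sigma>" "0 < \<kappa>\<^sub>v" "0 < \<kappa>\<^sub>c" "0 < \<theta>" "0 < \<omega>"
      "0 \<le> \<tau> * L + \<Gamma>"
    and v: "v \<in> range ((*v) (transpose (J y)))" "norm v \<le> \<omega> * norm (transpose (J y) *v c y)"
    and u: "reduced_solution (J y) B (- (g + B *v v)) u"
    and ut: "reduced_solution (J y) B (- (gradf y + B *v v)) ut"
    and w1: "reduced_solution (J y) B (gradf y) w1"
    and w2: "reduced_solution (J y) B ut w2"
    and a: "\<nu> \<le> a" "a \<le> \<nu> + \<theta> * \<beta>" "a \<le> 1"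
    and merit: "\<tau> * (gradf y \<bullet> (\<beta> *\<^sub>R ut + v) + \<beta> * (ut \<bullet> (B *v ut)))
        \<le> (1 - \<sigma>) * (norm (c y) - norm (c y + J y *v v))"
    and kappa_v: "norm (c y) * (norm (c y) - norm (c y + J y *v v))
        \<ge> \<kappa>\<^sub>v * (norm (transpose (J y) *v c y))\<^sup>2"
    and \<nu>: "2 * (\<tau> * L + \<Gamma>) * \<omega>\<^sup>2 * \<nu> * \<kappa>\<^sub>c \<le> \<sigma> * \<kappa>\<^sub>v"
    and \<kappa>\<^sub>u: "\<kappa>\<^sub>u = inverse \<zeta> * (\<kappa>\<^sub>g + \<kappa>\<^sub>H * \<omega> * \<kappa>\<^sub>J * \<kappa>\<^sub>c)"
  defines "\<phi> \<equiv> \<lambda>y. \<tau> * f y + norm (c y)"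
  shows "\<phi> (y + a *\<^sub>R (\<beta> *\<^sub>R u + v)) - \<phi> y \<le>
    - \<nu> * (\<sigma> / 2 * (norm (c y) - norm (c y + J y *v v)) + \<tau> * \<beta> * (ut \<bullet> (B *v ut)))
    - ((\<nu> * \<tau> * \<beta>) *\<^sub>R w1 + (\<beta>\<^sup>2 * (\<tau> * L + \<Gamma>)) *\<^sub>R w2) \<bullet> (g - gradf y)
    + \<beta>\<^sup>2 * (1/2 * (\<tau> * L + \<Gamma>) * (inverse \<zeta> * \<kappa>\<^sub>H * \<kappa>\<^sub>u\<^sup>2 + (inverse \<zeta>)\<^sup>2 * (norm (g - gradf y))\<^sup>2)
        + \<theta> * \<kappa>\<^sub>g * \<tau> * inverse \<zeta> * norm (g - gradf y)
        + \<theta>\<^sup>2 * (\<tau> * L + \<Gamma>) * \<omega>\<^sup>2 * \<kappa>\<^sub>J\<^sup>2 * \<kappa>\<^sub>c\<^sup>2)"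
proof -
  define S where "S = \<tau> * L + \<Gamma>"
  define \<Delta> where "\<Delta> = norm (c y) - norm (c y + J y *v v)"
  define q where "q = ut \<bullet> (B *v ut)"
  define e where "e = g - gradf y"
  define D where "D = u - ut"
  define N where "N = (norm (transpose (J y) *v c y))\<^sup>2"
  have sym: "transpose B = B"
    and coercive: "\<And>z. J y *v z = 0 \<Longrightarrow> z \<bullet> (B *v z) \<ge> \<zeta> * (norm z)\<^sup>2"
    using hess by (auto simp: hessian_assumption_def)
  note bd = tangential_solution_bounds[OF hess \<open>0 < \<zeta>\<close> ut v(2) \<open>0 < \<omega>\<close> bounds \<kappa>\<^sub>u]
  have Ju: "J y *v u = 0"
    using u by (simp add: reduced_solution_def)
  have D: "reduced_solution (J y) B (- e) D"
    using reduced_solution_diff[OF u ut] by (simp add: D_def e_def)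
  have gD: "gradf y \<bullet> D = - (w1 \<bullet> e)" and uD: "ut \<bullet> D = - (w2 \<bullet> e)"
    using reduced_solution_swap[OF sym w1 D] reduced_solution_swap[OF sym w2 D] by simp_all
  have nD: "norm D \<le> inverse \<zeta> * norm e"
    using reduced_solution_coercive[OF coercive \<open>0 < \<zeta>\<close> D] \<open>0 < \<zeta>\<close> by (simp add: field_simps)
  have q0: "0 \<le> q"
    unfolding q_def by (rule order_trans[OF _ bd(3)]) (use \<open>0 < \<zeta>\<close> in simp)
  \<comment> \<open>Null space and row space are orthogonal, so the squared length of the full step
    has no cross term.\<close>
  have "(\<beta> *\<^sub>R u) \<bullet> v = 0"
    using range_orthogonal_null[OF v(1) Ju] by (simp add: inner_commute)
  then have nd: "(norm (\<beta> *\<^sub>R u + v))\<^sup>2 = \<beta>\<^sup>2 * (norm u)\<^sup>2 + (norm v)\<^sup>2"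
    by (simp add: norm_pythagoras power_mult_distrib)
  have \<kappa>J: "0 \<le> \<kappa>\<^sub>J"
    by (rule op_norm_nonneg[OF bounds(3)])
  have nJ: "norm (transpose (J y) *v c y) \<le> \<kappa>\<^sub>J * \<kappa>\<^sub>c"
    using op_norm_transpose_bound[OF bounds(3)] mult_left_mono[OF bounds(2) \<kappa>J]
    by (meson order_trans)
  have N: "N \<le> \<kappa>\<^sub>J\<^sup>2 * \<kappa>\<^sub>c\<^sup>2"
    unfolding N_def power_mult_distrib[symmetric] using nJ by (intro power_mono) auto
  have nv: "(norm v)\<^sup>2 \<le> \<omega>\<^sup>2 * N"
    unfolding N_def power_mult_distrib[symmetric] using v(2) by (intro power_mono) auto
  have kN: "\<kappa>\<^sub>v * N \<le> \<kappa>\<^sub>c * \<Delta>"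
    unfolding N_def \<Delta>_def by (rule normal_step_decrease(2)[OF kappa_v \<open>0 < \<kappa>\<^sub>v\<close> v(2) bounds(2)])
  have "\<bar>gradf y \<bullet> D\<bar> \<le> norm (gradf y) * norm D"
    by (rule Cauchy_Schwarz_ineq2)
  also have "\<dots> \<le> \<kappa>\<^sub>g * norm D"
    by (intro mult_right_mono bounds) simp
  finally have m: "\<bar>gradf y \<bullet> D\<bar> \<le> \<kappa>\<^sub>g * norm D" .
  let ?t = "gradf y \<bullet> (\<beta> *\<^sub>R ut + v)"
  have "\<phi> (y + a *\<^sub>R (\<beta> *\<^sub>R u + v)) - \<phi> y
    \<le> a * (\<tau> * (gradf y \<bullet> (\<beta> *\<^sub>R u + v)) - (norm (c y) - norm (c y + J y *v (\<beta> *\<^sub>R u + v))))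
      + S / 2 * (a\<^sup>2 * (norm (\<beta> *\<^sub>R u + v))\<^sup>2)"
    unfolding \<phi>_def S_def using a pos by (intro merit_upper_bound[OF X f c J]) auto
  also have "gradf y \<bullet> (\<beta> *\<^sub>R u + v) = ?t + \<beta> * (gradf y \<bullet> D)"
    by (simp add: D_def inner_add_right inner_diff_right algebra_simps)
  also have "J y *v (\<beta> *\<^sub>R u + v) = J y *v v"
    by (simp add: matrix_vector_right_distrib matrix_vector_mult_scaleR Ju)
  also have "norm (c y) - norm (c y + J y *v v) = \<Delta>"
    by (simp add: \<Delta>_def)
  also have "a * (\<tau> * (?t + \<beta> * (gradf y \<bullet> D)) - \<Delta>) + S / 2 * (a\<^sup>2 * (norm (\<beta> *\<^sub>R u + v))\<^sup>2)
    \<le> - \<nu> * (\<sigma> / 2 * \<Delta> + \<tau> * \<beta> * q) + \<nu> * \<tau> * \<beta> * (gradf y \<bullet> D) + \<theta> * \<beta>\<^sup>2 * \<tau> * \<kappa>\<^sub>g * norm D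
      + S / 2 * (\<beta>\<^sup>2 * (norm u)\<^sup>2) + \<beta>\<^sup>2 * (\<theta>\<^sup>2 * S * \<omega>\<^sup>2 * (\<kappa>\<^sub>J\<^sup>2 * \<kappa>\<^sub>c\<^sup>2))"
    unfolding nd
    by (rule decrease_algebra[OF a, where \<kappa>\<^sub>v = \<kappa>\<^sub>v and \<kappa>\<^sub>c = \<kappa>\<^sub>c and N = N])
      (use pos q0 merit m nv kN N \<nu> in \<open>simp_all add: S_def \<Delta>_def q_def N_def\<close>)
  finally have main: "\<phi> (y + a *\<^sub>R (\<beta> *\<^sub>R u + v)) - \<phi> y
    \<le> - \<nu> * (\<sigma> / 2 * \<Delta> + \<tau> * \<beta> * q) + \<nu> * \<tau> * \<beta> * (gradf y \<bullet> D) + \<theta> * \<beta>\<^sup>2 * \<tau> * \<kappa>\<^sub>g * norm D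
      + S / 2 * (\<beta>\<^sup>2 * (norm u)\<^sup>2) + \<beta>\<^sup>2 * (\<theta>\<^sup>2 * S * \<omega>\<^sup>2 * (\<kappa>\<^sub>J\<^sup>2 * \<kappa>\<^sub>c\<^sup>2))" .
  have \<kappa>g: "0 \<le> \<kappa>\<^sub>g"
    using bounds(1) norm_ge_zero order_trans by blast
  have S0: "0 \<le> S"
    using pos by (simp add: S_def)
  have 1: "\<theta> * \<beta>\<^sup>2 * \<tau> * \<kappa>\<^sub>g * norm D \<le> \<theta> * \<beta>\<^sup>2 * \<tau> * \<kappa>\<^sub>g * (inverse \<zeta> * norm e)"
    using nD \<kappa>g pos by (intro mult_left_mono) auto
  have "(norm ut)\<^sup>2 \<le> inverse \<zeta> * q"
    using bd(3) \<open>0 < \<zeta>\<close> by (simp add: q_def field_simps)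
  also have "\<dots> \<le> inverse \<zeta> * (\<kappa>\<^sub>H * \<kappa>\<^sub>u\<^sup>2)"
    using bd(2) \<open>0 < \<zeta>\<close> by (intro mult_left_mono) (auto simp: q_def)
  finally have nut: "(norm ut)\<^sup>2 \<le> inverse \<zeta> * \<kappa>\<^sub>H * \<kappa>\<^sub>u\<^sup>2"
    by simp
  have nD2: "(norm D)\<^sup>2 \<le> (inverse \<zeta>)\<^sup>2 * (norm e)\<^sup>2"
    unfolding power_mult_distrib[symmetric] using nD by (intro power_mono) auto
  \<comment> \<open>The cross term is kept exact instead of being estimated: it is a test of the
    noise against \<open>w2\<close> and averages out. So the two squares enter
    \<open>\<kappa>\<^sub>1\<close> without an extra factor 2.\<close>
  have "(norm u)\<^sup>2 = (norm ut)\<^sup>2 + 2 * (ut \<bullet> D) + (norm D)\<^sup>2"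
    by (simp add: D_def power2_norm_eq_inner inner_diff_left inner_diff_right inner_commute)
  then have "(norm u)\<^sup>2 \<le> inverse \<zeta> * \<kappa>\<^sub>H * \<kappa>\<^sub>u\<^sup>2 + (inverse \<zeta>)\<^sup>2 * (norm e)\<^sup>2 - 2 * (w2 \<bullet> e)"
    using nut nD2 uD by linarith
  then have 2: "S / 2 * (\<beta>\<^sup>2 * (norm u)\<^sup>2)
      \<le> S / 2 * (\<beta>\<^sup>2 * (inverse \<zeta> * \<kappa>\<^sub>H * \<kappa>\<^sub>u\<^sup>2 + (inverse \<zeta>)\<^sup>2 * (norm e)\<^sup>2 - 2 * (w2 \<bullet> e)))"
    using S0 by (intro mult_left_mono) auto
  show ?thesis
    unfolding e_def[symmetric] S_def[symmetric] \<Delta>_def[symmetric] q_def[symmetric]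
    using main 1 2 by (simp add: gD inner_add_left algebra_simps)
qed

subsection \<open>Conditional noise and the complexity bound\<close>

text \<open>\<open>gradf\<close> and \<open>J\<close> are controlled only on \<open>X\<close>, so
  the composition is factored through the Borel sigma-algebra restricted to
  \<open>X\<close>.\<close>

lemma borel_measurable_compose_continuous_on:
  assumes "continuous_on X h" "y \<in> borel_measurable N" "\<And>s. s \<in> space N \<Longrightarrow> y s \<in> X"
  shows "(\<lambda>s. h (y s)) \<in> borel_measurable N"
proof -
  have "y \<in> measurable N (restrict_space borel X)"
    using assms by (intro measurable_restrict_space2) auto
  then show ?thesis
    by (rule measurable_compose) (rule borel_measurable_continuous_on_restrict[OF assms(1)])
qed

text \<open>The conditional second moment in \<open>ennreal\<close> yields square integrability
  first, and this makes the conditional means meaningful. The inner product with a bounded,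
  \<open>F\<close>-measurable \<open>w\<close> is then averaged coordinate by coordinate.\<close>

lemma (in prob_space) conditional_noise:
  fixes g G :: "'a \<Rightarrow> real^'n"
  assumes sub: "subalgebra M F"
    and g: "g \<in> borel_measurable M" and G: "G \<in> borel_measurable F"
    and Gb: "\<And>s. s \<in> space M \<Longrightarrow> norm (G s) \<le> b"
    and mean: "\<And>i. AE s in M. real_cond_exp M F (\<lambda>s. g s $ i) s = G s $ i"
    and var: "AE s in M. nn_cond_exp M F (\<lambda>s. ennreal ((norm (g s - G s))\<^sup>2)) s \<le> ennreal V"
    and V: "0 < V"
  shows "integrable M (\<lambda>s. (norm (g s - G s))\<^sup>2)" (is ?int2)
    and "expectation (\<lambda>s. (norm (g s - G s))\<^sup>2) \<le> V"
    and "integrable M (\<lambda>s. norm (g s - G s))" (is ?int1)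
    and "expectation (\<lambda>s. norm (g s - G s)) \<le> sqrt V"
    and "\<And>w. w \<in> borel_measurable F \<Longrightarrow> (\<And>s. s \<in> space M \<Longrightarrow> norm (w s) \<le> r) \<Longrightarrow>
        integrable M (\<lambda>s. w s \<bullet> (g s - G s)) \<and> expectation (\<lambda>s. w s \<bullet> (g s - G s)) = 0"
proof -
  interpret finite_measure_subalgebra M F
    by standard (rule sub)
  have GM: "G \<in> borel_measurable M"
    by (rule measurable_from_subalg[OF sub G])
  note [measurable] = g GM
  have "(\<integral>\<^sup>+s. ennreal ((norm (g s - G s))\<^sup>2) \<partial>M)
      = (\<integral>\<^sup>+s. nn_cond_exp M F (\<lambda>s. ennreal ((norm (g s - G s))\<^sup>2)) s \<partial>M)"
    using nn_cond_exp_intg[of "\<lambda>_. 1" "\<lambda>s. ennreal ((norm (g s - G s))\<^sup>2)"] by simp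
  also have "\<dots> \<le> (\<integral>\<^sup>+s. ennreal V \<partial>M)"
    by (rule nn_integral_mono_AE[OF var])
  also have "\<dots> = ennreal V"
    by (simp add: emeasure_space_1)
  finally have nn: "(\<integral>\<^sup>+s. ennreal ((norm (g s - G s))\<^sup>2) \<partial>M) \<le> ennreal V" .
  show int2: ?int2
    by (rule integrableI_nonneg) (use le_less_trans[OF nn] in auto)
  show E2: "expectation (\<lambda>s. (norm (g s - G s))\<^sup>2) \<le> V"
    using nn V unfolding nn_integral_eq_integral[OF int2, simplified] by (simp add: ennreal_le_iff)
  \<comment> \<open>Weighting the arithmetic-geometric mean inequality by \<open>sqrt V\<close>
    gives both integrability and, after averaging, exactly the bound \<open>sqrt V\<close>.\<close>
  have amgm: "norm (g s - G s) \<le> ((norm (g s - G s))\<^sup>2 / sqrt V + sqrt V) / 2" for s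
  proof -
    have "0 \<le> (norm (g s - G s) - sqrt V)\<^sup>2"
      by simp
    then show ?thesis
      using V by (simp add: power2_diff field_simps)
  qed
  have intd: "integrable M (\<lambda>s. ((norm (g s - G s))\<^sup>2 / sqrt V + sqrt V) / 2)"
    using int2 by simp
  show int1: ?int1
    by (rule Bochner_Integration.integrable_bound[OF intd])
      (measurable, intro AE_I2, simp only: real_norm_def abs_norm_cancel order_trans[OF amgm abs_ge_self])
  have "expectation (\<lambda>s. norm (g s - G s)) \<le> expectation (\<lambda>s. ((norm (g s - G s))\<^sup>2 / sqrt V + sqrt V) / 2)"
    by (intro integral_mono int1 intd amgm)
  also have "\<dots> = (expectation (\<lambda>s. (norm (g s - G s))\<^sup>2) / sqrt V + sqrt V) / 2"
    using int2 by (simp add: prob_space)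
  also have "\<dots> \<le> (V / sqrt V + sqrt V) / 2"
    using E2 V by (intro divide_right_mono add_right_mono) auto
  also have "\<dots> = sqrt V"
    using V by (simp add: real_div_sqrt)
  finally show "expectation (\<lambda>s. norm (g s - G s)) \<le> sqrt V" .
  fix w :: "'a \<Rightarrow> real^'n"
  assume w: "w \<in> borel_measurable F" and wb: "\<And>s. s \<in> space M \<Longrightarrow> norm (w s) \<le> r"
  have wM: "w \<in> borel_measurable M"
    by (rule measurable_from_subalg[OF sub w])
  note wi = borel_measurable_vec_nth[OF w] and wMi [measurable] = borel_measurable_vec_nth[OF wM]
  note gi [measurable] = borel_measurable_vec_nth[OF g] and Gi [measurable] = borel_measurable_vec_nth[OF GM]
  have intG: "integrable M (\<lambda>s. w s $ i * G s $ i)" for i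
  proof (rule integrable_const_bound)
    show "AE s in M. norm (w s $ i * G s $ i) \<le> r * b"
    proof (rule AE_I2)
      fix s assume s: "s \<in> space M"
      have "\<bar>w s $ i\<bar> * \<bar>G s $ i\<bar> \<le> r * b"
        using component_le_norm_cart[of "w s" i] component_le_norm_cart[of "G s" i] wb[OF s] Gb[OF s]
        by (intro mult_mono) (auto intro: order_trans[OF norm_ge_zero])
      then show "norm (w s $ i * G s $ i) \<le> r * b"
        by (simp add: abs_mult)
    qed
  qed measurable
  have inte: "integrable M (\<lambda>s. w s $ i * (g s - G s) $ i)" for i
  proof (rule Bochner_Integration.integrable_bound)
    show "integrable M (\<lambda>s. r * norm (g s - G s))"
      using int1 by simp
    show "AE s in M. norm (w s $ i * (g s - G s) $ i) \<le> norm (r * norm (g s - G s))"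
    proof (rule AE_I2)
      fix s assume s: "s \<in> space M"
      have "\<bar>w s $ i\<bar> * \<bar>(g s - G s) $ i\<bar> \<le> r * norm (g s - G s)"
        using component_le_norm_cart[of "w s" i] component_le_norm_cart[of "g s - G s" i] wb[OF s]
        by (intro mult_mono) (auto intro: order_trans[OF norm_ge_zero])
      moreover have "0 \<le> r"
        using wb[OF s] norm_ge_zero order_trans by blast
      ultimately show "norm (w s $ i * (g s - G s) $ i) \<le> norm (r * norm (g s - G s))"
        by (simp add: abs_mult)
    qed
  qed (simp only: vector_minus_component, measurable)
  \<comment> \<open>Pulling \<open>w\<close> out of the conditional expectation requires this
    product to be integrable; it is the sum of a bounded part and a noise part.\<close>
  have intg: "integrable M (\<lambda>s. w s $ i * g s $ i)" for i
    using Bochner_Integration.integrable_add[OF inte[of i] intG[of i]] by (simp add: algebra_simps)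
  have "expectation (\<lambda>s. w s $ i * g s $ i) = expectation (\<lambda>s. w s $ i * G s $ i)" for i
  proof -
    have "expectation (\<lambda>s. w s $ i * g s $ i)
        = expectation (\<lambda>s. w s $ i * real_cond_exp M F (\<lambda>s. g s $ i) s)"
      by (rule real_cond_exp_intg(2)[symmetric, OF intg wi gi])
    also have "\<dots> = expectation (\<lambda>s. w s $ i * G s $ i)"
      by (rule integral_cong_AE) (use mean[of i] in \<open>auto elim: eventually_mono\<close>)
    finally show ?thesis .
  qed
  then have zero: "expectation (\<lambda>s. w s $ i * (g s - G s) $ i) = 0" for i
    using Bochner_Integration.integral_diff[OF intg[of i] intG[of i]] by (simp add: algebra_simps)
  have eq: "(\<lambda>s. w s \<bullet> (g s - G s)) = (\<lambda>s. \<Sum>i\<in>UNIV. w s $ i * (g s - G s) $ i)"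
    by (simp add: inner_vec_def)
  show "integrable M (\<lambda>s. w s \<bullet> (g s - G s)) \<and> expectation (\<lambda>s. w s \<bullet> (g s - G s)) = 0"
    unfolding eq using inte zero by (simp only: Bochner_Integration.integrable_sum Bochner_Integration.integral_sum sum.neutral_const simp_thms)
qed

text \<open>\<open>A\<close>, \<open>Q\<close> and \<open>R\<close> are the sums over the iterations
  of the expected linearized decrease, curvature and squared residual. Both summands in the bound by
  \<open>\<kappa>\<^sub>2\<close> are nonnegative, so each is bounded separately: \<open>A\<close>
  by a constant and \<open>Q\<close> by a multiple of \<open>sqrt K\<close>.\<close>

lemma complexity_algebra:
  fixes A Q R \<kappa>\<^sub>H \<nu> :: real
  assumes pos: "0 < \<nu>" "0 < \<sigma>" "0 < \<tau>" "0 < \<eta>" "0 < \<zeta>" "0 < \<kappa>\<^sub>v" "0 < \<kappa>\<^sub>c" "0 < K" "0 < \<omega>"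
    and nonneg: "0 \<le> A" "0 \<le> Q" "0 \<le> \<kappa>\<^sub>H"
    and R: "R \<le> \<kappa>\<^sub>H\<^sup>2 * (\<omega>\<^sup>2 * \<kappa>\<^sub>c / \<kappa>\<^sub>v * A + Q / \<zeta>)"
    and AQ: "\<nu> * (\<sigma> / 2 * A + \<tau> * (\<eta> / sqrt K) * Q) \<le> \<kappa>\<^sub>2"
    and \<kappa>\<^sub>0: "\<kappa>\<^sub>0 = \<omega>\<^sup>2 * (2 * \<kappa>\<^sub>H + 2 * inverse \<zeta> * \<kappa>\<^sub>H\<^sup>2 + \<zeta>)"
  shows "1 / K * R \<le> 2 * \<kappa>\<^sub>H\<^sup>2 * \<kappa>\<^sub>2 / (\<nu> * \<eta> * \<tau> * \<zeta> * sqrt K)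
      + 4 * \<kappa>\<^sub>H\<^sup>2 * \<kappa>\<^sub>c * \<kappa>\<^sub>0 * \<kappa>\<^sub>2 / (\<nu> * \<sigma> * \<kappa>\<^sub>v * \<zeta> * K)"
proof -
  have Ab: "\<nu> * (\<sigma> / 2 * A) \<le> \<kappa>\<^sub>2" and Qb: "\<nu> * (\<tau> * (\<eta> / sqrt K) * Q) \<le> \<kappa>\<^sub>2"
  proof -
    have "0 \<le> \<nu> * (\<sigma> / 2 * A)" "0 \<le> \<nu> * (\<tau> * (\<eta> / sqrt K) * Q)"
      using pos nonneg by simp_all
    then show "\<nu> * (\<sigma> / 2 * A) \<le> \<kappa>\<^sub>2" "\<nu> * (\<tau> * (\<eta> / sqrt K) * Q) \<le> \<kappa>\<^sub>2"
      using AQ by (simp_all only: distrib_left)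
  qed
  have "0 \<le> \<nu> * (\<sigma> / 2 * A)"
    using pos nonneg by simp
  then have \<kappa>2: "0 \<le> \<kappa>\<^sub>2"
    using Ab by linarith
  have A: "A \<le> 2 * \<kappa>\<^sub>2 / (\<nu> * \<sigma>)"
    using Ab pos by (simp add: field_simps)
  have Q: "Q \<le> \<kappa>\<^sub>2 * sqrt K / (\<nu> * \<tau> * \<eta>)"
    using Qb pos by (simp add: field_simps)
  \<comment> \<open>The summand \<zeta> of \<open>\<kappa>\<^sub>0\<close> is what lets
    \<open>\<omega>\<^sup>2\<close> be replaced by
    \<open>\<kappa>\<^sub>0 / \<zeta>\<close>.\<close>
  have "\<omega>\<^sup>2 * \<zeta> \<le> \<kappa>\<^sub>0"
    unfolding \<kappa>\<^sub>0 using pos nonneg by (intro mult_left_mono) auto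
  then have \<omega>: "\<omega>\<^sup>2 \<le> \<kappa>\<^sub>0 / \<zeta>"
    using pos by (simp add: field_simps)
  have \<kappa>0: "0 \<le> \<kappa>\<^sub>0 / \<zeta>"
    using \<omega> by (rule order_trans[rotated]) simp
  have "\<omega>\<^sup>2 * \<kappa>\<^sub>c / \<kappa>\<^sub>v * A \<le> \<kappa>\<^sub>0 / \<zeta> * \<kappa>\<^sub>c / \<kappa>\<^sub>v * (2 * \<kappa>\<^sub>2 / (\<nu> * \<sigma>))"
  proof (rule mult_mono)
    show "\<omega>\<^sup>2 * \<kappa>\<^sub>c / \<kappa>\<^sub>v \<le> \<kappa>\<^sub>0 / \<zeta> * \<kappa>\<^sub>c / \<kappa>\<^sub>v"
      using pos by (intro divide_right_mono mult_right_mono \<omega>) auto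
    show "0 \<le> \<kappa>\<^sub>0 / \<zeta> * \<kappa>\<^sub>c / \<kappa>\<^sub>v"
      using pos by (intro divide_nonneg_nonneg[OF mult_nonneg_nonneg[OF \<kappa>0]]) auto
  qed (rule A, rule nonneg)
  moreover have "Q / \<zeta> \<le> (\<kappa>\<^sub>2 * sqrt K / (\<nu> * \<tau> * \<eta>)) / \<zeta>"
    using pos by (intro divide_right_mono Q) auto
  ultimately have "\<kappa>\<^sub>H\<^sup>2 * (\<omega>\<^sup>2 * \<kappa>\<^sub>c / \<kappa>\<^sub>v * A + Q / \<zeta>)
      \<le> \<kappa>\<^sub>H\<^sup>2 * (\<kappa>\<^sub>0 / \<zeta> * \<kappa>\<^sub>c / \<kappa>\<^sub>v * (2 * \<kappa>\<^sub>2 / (\<nu> * \<sigma>)) + (\<kappa>\<^sub>2 * sqrt K / (\<nu> * \<tau> * \<eta>)) / \<zeta>)"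
    by (intro mult_left_mono add_mono) simp_all
  with R have "1 / K * R \<le> 1 / K * (\<kappa>\<^sub>H\<^sup>2 * (\<kappa>\<^sub>0 / \<zeta> * \<kappa>\<^sub>c / \<kappa>\<^sub>v * (2 * \<kappa>\<^sub>2 / (\<nu> * \<sigma>))
      + (\<kappa>\<^sub>2 * sqrt K / (\<nu> * \<tau> * \<eta>)) / \<zeta>))"
    using pos by (intro mult_left_mono) auto
  also have "\<dots> = \<kappa>\<^sub>H\<^sup>2 * \<kappa>\<^sub>2 / (\<nu> * \<eta> * \<tau> * \<zeta> * sqrt K)
      + 2 * \<kappa>\<^sub>H\<^sup>2 * \<kappa>\<^sub>c * \<kappa>\<^sub>0 * \<kappa>\<^sub>2 / (\<nu> * \<sigma> * \<kappa>\<^sub>v * \<zeta> * K)"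
  proof -
    have "sqrt K / K = 1 / sqrt K"
      using pos by (simp add: field_simps)
    have "1 / K * (\<kappa>\<^sub>H\<^sup>2 * ((\<kappa>\<^sub>2 * sqrt K / (\<nu> * \<tau> * \<eta>)) / \<zeta>))
        = \<kappa>\<^sub>H\<^sup>2 * \<kappa>\<^sub>2 / (\<nu> * \<eta> * \<tau> * \<zeta>) * (sqrt K / K)"
      by (simp add: ac_simps)
    also have "\<dots> = \<kappa>\<^sub>H\<^sup>2 * \<kappa>\<^sub>2 / (\<nu> * \<eta> * \<tau> * \<zeta> * sqrt K)"
      unfolding \<open>sqrt K / K = 1 / sqrt K\<close> by simp
    moreover have "1 / K * (\<kappa>\<^sub>H\<^sup>2 * (\<kappa>\<^sub>0 / \<zeta> * \<kappa>\<^sub>c / \<kappa>\<^sub>v * (2 * \<kappa>\<^sub>2 / (\<nu> * \<sigma>))))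
        = 2 * \<kappa>\<^sub>H\<^sup>2 * \<kappa>\<^sub>c * \<kappa>\<^sub>0 * \<kappa>\<^sub>2 / (\<nu> * \<sigma> * \<kappa>\<^sub>v * \<zeta> * K)"
      by (simp add: ac_simps)
    ultimately show ?thesis
      unfolding distrib_left by linarith
  qed
  \<comment> \<open>Each term reached so far is half of its counterpart in the claim, since
    orthogonality avoids the factor 2 of the general bound for the square of a sum. Doubling is
    legitimate because both terms are nonnegative.\<close>
  also have "\<dots> \<le> 2 * (\<kappa>\<^sub>H\<^sup>2 * \<kappa>\<^sub>2 / (\<nu> * \<eta> * \<tau> * \<zeta> * sqrt K))
      + 2 * (2 * \<kappa>\<^sub>H\<^sup>2 * \<kappa>\<^sub>c * \<kappa>\<^sub>0 * \<kappa>\<^sub>2 / (\<nu> * \<sigma> * \<kappa>\<^sub>v * \<zeta> * K))"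
  proof -
    have "0 \<le> \<kappa>\<^sub>H\<^sup>2 * \<kappa>\<^sub>2 / (\<nu> * \<eta> * \<tau> * \<zeta> * sqrt K)"
      using pos \<kappa>2 by simp
    moreover have "0 \<le> \<kappa>\<^sub>0"
      using \<kappa>0 pos by (simp add: zero_le_divide_iff)
    then have "0 \<le> 2 * \<kappa>\<^sub>H\<^sup>2 * \<kappa>\<^sub>c * \<kappa>\<^sub>0 * \<kappa>\<^sub>2 / (\<nu> * \<sigma> * \<kappa>\<^sub>v * \<zeta> * K)"
      using pos \<kappa>2 by simp
    moreover have "y \<le> 2 * y" if "0 \<le> y" for y :: real
      using that by simp
    ultimately show ?thesis by (intro add_mono)
  qed
  finally show ?thesis
    by (simp add: ac_simps)
qed

section \<open>Averaging, telescoping and the stationarity residual\<close>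

theorem corollary3p13:
  fixes P :: "'s measure" and F :: "nat \<Rightarrow> 's measure"
    and f :: "real^'n \<Rightarrow> real" and gradf :: "real^'n \<Rightarrow> real^'n"
    and c :: "real^'n \<Rightarrow> real^'m" and J :: "real^'n \<Rightarrow> real^'n^'m"
    and X :: "(real^'n) set" and x0 :: "real^'n"
    and x v g u d utrue dtrue :: "nat \<Rightarrow> 's \<Rightarrow> real^'n"
    and H :: "nat \<Rightarrow> 's \<Rightarrow> real^'n^'n" and ytrue :: "nat \<Rightarrow> 's \<Rightarrow> real^'m"
    and \<alpha> :: "nat \<Rightarrow> 's \<Rightarrow> real" and \<beta> :: "nat \<Rightarrow> real" and K :: nat
    and L \<Gamma> f\<^sub>i\<^sub>n\<^sub>f \<kappa>\<^sub>g \<kappa>\<^sub>c \<kappa>\<^sub>J \<kappa>\<^sub>H \<zeta> M \<omega> \<epsilon>\<^sub>v \<kappa>\<^sub>\<beta> \<sigma> \<tau>\<^sub>m\<^sub>i\<^sub>n \<kappa>\<^sub>v \<theta> \<nu> \<eta> \<kappa>\<^sub>u \<kappa>\<^sub>0 \<kappa>\<^sub>1 \<kappa>\<^sub>2 :: real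
  assumes prob: "prob_space P"
    and algorithm: "exact_algorithm P F c J \<omega> \<epsilon>\<^sub>v \<kappa>\<^sub>\<beta> \<beta> x0 x v H g u d \<alpha>"
    and smoothness: "smoothness_assumption P x X f gradf c J L \<Gamma>"
    and smoothness_constants: "0 < \<kappa>\<^sub>g" "0 < \<kappa>\<^sub>c" "0 < \<kappa>\<^sub>J"
      "\<And>k s. s \<in> space P \<Longrightarrow>
         f\<^sub>i\<^sub>n\<^sub>f \<le> f (x k s) \<and> norm (gradf (x k s)) \<le> \<kappa>\<^sub>g \<and>
         norm (c (x k s)) \<le> \<kappa>\<^sub>c \<and> op_norm (J (x k s)) \<le> \<kappa>\<^sub>J"
    and hessian: "0 < \<zeta>"
      "\<And>k s. s \<in> space P \<Longrightarrow> hessian_assumption (J (x k s)) (H k s) \<kappa>\<^sub>H \<zeta>"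
    and gradient: "0 < M" "gradient_assumption P F gradf x g M"
    and utrue: "\<And>k s. s \<in> space P \<Longrightarrow>
         tangential_step (gradf (x k s)) (H k s) (J (x k s)) (v k s) (utrue k s)"
    and dtrue: "\<And>k s. s \<in> space P \<Longrightarrow> dtrue k s = \<beta> k *\<^sub>R utrue k s + v k s"
    and ytrue: "\<And>k s. s \<in> space P \<Longrightarrow>
         ytrue k s = - (pinv (transpose (J (x k s))) *v
                          (gradf (x k s) + H k s *v v k s + H k s *v utrue k s))"
    and merit: "0 < \<sigma>" "\<sigma> < 1" "0 < \<tau>\<^sub>m\<^sub>i\<^sub>n"
      "\<And>k s. s \<in> space P \<Longrightarrow>
         \<tau>\<^sub>m\<^sub>i\<^sub>n * (gradf (x k s) \<bullet> dtrue k s + \<beta> k * (utrue k s \<bullet> (H k s *v utrue k s)))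
           \<le> (1 - \<sigma>) * (norm (c (x k s)) - norm (c (x k s) + J (x k s) *v v k s))"
    and kappa_v: "0 < \<kappa>\<^sub>v"
      "\<And>k s. s \<in> space P \<Longrightarrow>
         norm (c (x k s)) * (norm (c (x k s)) - norm (c (x k s) + J (x k s) *v v k s))
           \<ge> \<kappa>\<^sub>v * (norm (transpose (J (x k s)) *v c (x k s)))\<^sup>2"
    and kappa_u: "\<kappa>\<^sub>u = inverse \<zeta> * (\<kappa>\<^sub>g + \<kappa>\<^sub>H * \<omega> * \<kappa>\<^sub>J * \<kappa>\<^sub>c)"
    and kappa_0: "\<kappa>\<^sub>0 = \<omega>\<^sup>2 * (2 * \<kappa>\<^sub>H + 2 * inverse \<zeta> * \<kappa>\<^sub>H\<^sup>2 + \<zeta>)"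
    and kappa_1: "\<kappa>\<^sub>1 =
         1/2 * (\<tau>\<^sub>m\<^sub>i\<^sub>n * L + \<Gamma>) * (inverse \<zeta> * \<kappa>\<^sub>H * \<kappa>\<^sub>u\<^sup>2 + (inverse \<zeta>)\<^sup>2 * M)
         + \<theta> * \<kappa>\<^sub>g * \<tau>\<^sub>m\<^sub>i\<^sub>n * inverse \<zeta> * sqrt M
         + \<theta>\<^sup>2 * (\<tau>\<^sub>m\<^sub>i\<^sub>n * L + \<Gamma>) * \<omega>\<^sup>2 * \<kappa>\<^sub>J\<^sup>2 * \<kappa>\<^sub>c\<^sup>2"
    and kappa_2: "\<kappa>\<^sub>2 = \<tau>\<^sub>m\<^sub>i\<^sub>n * (f x0 - f\<^sub>i\<^sub>n\<^sub>f) + norm (c x0) + \<eta>\<^sup>2 * \<kappa>\<^sub>1"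
    and stepsize: "0 < \<theta>"
      "\<nu> \<in> {0 <.. min (\<sigma> * \<kappa>\<^sub>v * inverse \<kappa>\<^sub>c / (2 * (\<tau>\<^sub>m\<^sub>i\<^sub>n * L + \<Gamma>) * \<omega>\<^sup>2)) (1 - \<theta> * \<kappa>\<^sub>\<beta>)}"
      "\<And>k s. s \<in> space P \<Longrightarrow> \<alpha> k s \<in> {\<nu> .. \<nu> + \<theta> * \<beta> k}"
    and horizon: "0 < K" "0 < \<eta>" "\<And>k. k < K \<Longrightarrow> \<beta> k = \<eta> / sqrt (real K)"
  shows "1 / real K *
      (\<Sum>k<K. prob_space.expectation P
                (\<lambda>s. (norm (gradf (x k s) + transpose (J (x k s)) *v ytrue k s))\<^sup>2))
    \<le> 2 * \<kappa>\<^sub>H\<^sup>2 * \<kappa>\<^sub>2 / (\<nu> * \<eta> * \<tau>\<^sub>m\<^sub>i\<^sub>n * \<zeta> * sqrt (real K))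
      + 4 * \<kappa>\<^sub>H\<^sup>2 * \<kappa>\<^sub>c * \<kappa>\<^sub>0 * \<kappa>\<^sub>2 / (\<nu> * \<sigma> * \<kappa>\<^sub>v * \<zeta> * real K)"
proof -
  interpret prob_space P by (rule prob)
  define S where "S = \<tau>\<^sub>m\<^sub>i\<^sub>n * L + \<Gamma>"
  have X: "open X" "convex X" "\<And>k s. s \<in> space P \<Longrightarrow> x k s \<in> X"
    and f: "\<And>z. z \<in> X \<Longrightarrow> GDERIV f z :> gradf z" "L-lipschitz_on X gradf"
    and gradf_cont: "continuous_on X gradf" and J_cont: "continuous_on X J"
    and f_bdd: "bounded (f ` X)"
    and c: "\<And>z. z \<in> X \<Longrightarrow> (c has_derivative (*v) (J z)) (at z)"
    and J: "\<And>y z. y \<in> X \<Longrightarrow> z \<in> X \<Longrightarrow> op_norm (J y - J z) \<le> \<Gamma> * norm (y - z)"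
    and LG: "0 < L" "0 < \<Gamma>"
    using smoothness unfolding smoothness_assumption_def by blast+
  have f_cont: "continuous_on X f"
    using f(1) has_derivative_continuous unfolding gderiv_def
    by (intro continuous_at_imp_continuous_on) blast
  have c_cont: "continuous_on X c"
    using c has_derivative_continuous by (intro continuous_at_imp_continuous_on) blast
  have S: "0 < S"
    using LG merit(3) by (simp add: S_def add_pos_pos)
  have sub: "\<And>k. subalgebra P (F k)" and \<omega>: "0 < \<omega>"
    and x0: "\<And>s. s \<in> space P \<Longrightarrow> x 0 s = x0"
    and meas: "\<And>k. x k \<in> borel_measurable (F k)" "\<And>k. v k \<in> borel_measurable (F k)"
      "\<And>k. H k \<in> borel_measurable (F k)"
    and \<beta>: "\<And>k. 0 < \<beta> k" "\<And>k. \<beta> k \<le> \<kappa>\<^sub>\<beta>"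
    and step: "\<And>k s. s \<in> space P \<Longrightarrow> normal_step \<omega> \<epsilon>\<^sub>v (c (x k s)) (J (x k s)) (v k s)"
      "\<And>k s. s \<in> space P \<Longrightarrow> tangential_step (g k s) (H k s) (J (x k s)) (v k s) (u k s)"
      "\<And>k s. s \<in> space P \<Longrightarrow> x (Suc k) s = x k s + \<alpha> k s *\<^sub>R (\<beta> k *\<^sub>R u k s + v k s)"
    using algorithm unfolding exact_algorithm_def by (blast, blast, blast, blast, blast, blast, blast, blast, blast, blast, metis)
  have spF: "space (F k) = space P" for k
    using sub[of k] by (simp add: subalgebra_def)
  have v: "v k s \<in> range ((*v) (transpose (J (x k s))))"
    "norm (v k s) \<le> \<omega> * norm (transpose (J (x k s)) *v c (x k s))" if "s \<in> space P" for k s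
    using step(1)[OF that] by (auto simp: normal_step_def)
  have H: "transpose (H k s) = H k s" "op_norm (H k s) \<le> \<kappa>\<^sub>H"
    "J (x k s) *v z = 0 \<Longrightarrow> z \<bullet> (H k s *v z) \<ge> \<zeta> * (norm z)\<^sup>2" if "s \<in> space P" for k s z
    using hessian(2)[OF that] by (auto simp: hessian_assumption_def)
  \<comment> \<open>The sign of \<open>\<kappa>\<^sub>H\<close> is read off from an actual Hessian,
    so some outcome must exist.\<close>
  obtain s0 where "s0 \<in> space P"
    using not_empty by blast
  then have \<kappa>H: "0 \<le> \<kappa>\<^sub>H"
    using H(2) op_norm_nonneg by blast
  have u: "reduced_solution (J (x k s)) (H k s) (- (g k s + H k s *v v k s)) (u k s)"
    and ut: "reduced_solution (J (x k s)) (H k s) (- (gradf (x k s) + H k s *v v k s)) (utrue k s)"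
    if "s \<in> space P" for k s
    by (rule tangential_step_reduced_solution[OF H(1)[OF that] step(2)[OF that]])
      (rule tangential_step_reduced_solution[OF H(1)[OF that] utrue[OF that]])
  \<comment> \<open>A pointwise choice does no harm to measurability: coercivity makes the solution
    unique, so it agrees with the one given by Cramer's rule.\<close>
  define w1 where "w1 k s = (SOME w. reduced_solution (J (x k s)) (H k s) (gradf (x k s)) w)" for k s
  define w2 where "w2 k s = (SOME w. reduced_solution (J (x k s)) (H k s) (utrue k s) w)" for k s
  have w1: "reduced_solution (J (x k s)) (H k s) (gradf (x k s)) (w1 k s)"
    and w2: "reduced_solution (J (x k s)) (H k s) (utrue k s) (w2 k s)" if "s \<in> space P" for k s
    unfolding w1_def w2_def
    by (rule someI_ex[OF reduced_solution_exists[OF H(3)[OF that] hessian(1)]], assumption)+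
  have measJ: "(\<lambda>s. J (x k s)) \<in> borel_measurable (F k)"
    and measgrad: "(\<lambda>s. gradf (x k s)) \<in> borel_measurable (F k)"
    and measf: "(\<lambda>s. f (x k s)) \<in> borel_measurable (F k)"
    and measc: "(\<lambda>s. c (x k s)) \<in> borel_measurable (F k)" for k
    using X(3) by (auto intro!: borel_measurable_compose_continuous_on[OF _ meas(1)]
        J_cont gradf_cont f_cont c_cont simp: spF)
  note reduced_meas = borel_measurable_reduced_solution[OF measJ meas(3) _ hessian(1), unfolded spF, OF _ H(3)]
  have "(\<lambda>s. - (gradf (x k s) + H k s *v v k s)) \<in> borel_measurable (F k)" for k
    by (intro borel_measurable_uminus borel_measurable_add measgrad borel_measurable_matrix_vector_mult meas)
  then have measut: "utrue k \<in> borel_measurable (F k)" for k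
    by (rule reduced_meas[OF _ _ _ ut])
  have measw1: "w1 k \<in> borel_measurable (F k)" for k
    by (rule reduced_meas[OF measgrad _ _ w1])
  have measw2: "w2 k \<in> borel_measurable (F k)" for k
    by (rule reduced_meas[OF measut _ _ w2])
  note bd = tangential_solution_bounds[OF hessian(2) hessian(1) ut v(2) \<omega> _ _ _ kappa_u]
  have ub: "norm (utrue k s) \<le> \<kappa>\<^sub>u" "utrue k s \<bullet> (H k s *v utrue k s) \<le> \<kappa>\<^sub>H * \<kappa>\<^sub>u\<^sup>2"
    "\<zeta> * (norm (utrue k s))\<^sup>2 \<le> utrue k s \<bullet> (H k s *v utrue k s)"
    "norm (v k s) \<le> \<omega> * (\<kappa>\<^sub>J * \<kappa>\<^sub>c)" if "s \<in> space P" for k s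
    using bd[OF that that that] smoothness_constants(4)[OF that] by blast+
  define \<Delta> where "\<Delta> k s = norm (c (x k s)) - norm (c (x k s) + J (x k s) *v v k s)" for k s
  define q where "q k s = utrue k s \<bullet> (H k s *v utrue k s)" for k s
  define e where "e k s = g k s - gradf (x k s)" for k s
  define \<phi> where "\<phi> k s = \<tau>\<^sub>m\<^sub>i\<^sub>n * f (x k s) + norm (c (x k s))" for k s
  \<comment> \<open>Both mean-zero terms of the one-step estimate are collected in one bounded,
    \<open>F k\<close>-measurable test vector.\<close>
  define W where "W k s = (\<nu> * \<tau>\<^sub>m\<^sub>i\<^sub>n * \<beta> k) *\<^sub>R w1 k s + ((\<beta> k)\<^sup>2 * S) *\<^sub>R w2 k s" for k s
  have \<nu>: "0 < \<nu>" "\<nu> \<le> \<sigma> * \<kappa>\<^sub>v * inverse \<kappa>\<^sub>c / (2 * S * \<omega>\<^sup>2)" "\<nu> \<le> 1 - \<theta> * \<kappa>\<^sub>\<beta>"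
    using stepsize(2) by (auto simp: S_def)
  have \<nu>S: "2 * S * \<omega>\<^sup>2 * \<nu> * \<kappa>\<^sub>c \<le> \<sigma> * \<kappa>\<^sub>v"
    using \<nu>(2) S \<omega> smoothness_constants(2) by (simp add: field_simps)
  have \<alpha>: "\<nu> \<le> \<alpha> k s" "\<alpha> k s \<le> \<nu> + \<theta> * \<beta> k" "\<alpha> k s \<le> 1" if "s \<in> space P" for k s
  proof -
    show 1: "\<nu> \<le> \<alpha> k s" "\<alpha> k s \<le> \<nu> + \<theta> * \<beta> k"
      using stepsize(3)[OF that] by auto
    \<comment> \<open>The bound \<open>\<nu> \<le> 1 - \<theta> * \<kappa>\<^sub>\<beta>\<close>
      keeps the stepsize at most 1, as the convexity argument for the linearized constraint
      requires.\<close>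
    have "\<theta> * \<beta> k \<le> \<theta> * \<kappa>\<^sub>\<beta>"
      using \<beta>(2) stepsize(1) by (intro mult_left_mono) auto
    then show "\<alpha> k s \<le> 1"
      using 1 \<nu>(3) by linarith
  qed
  have \<Delta>0: "0 \<le> \<Delta> k s" and \<Delta>c: "\<Delta> k s \<le> \<kappa>\<^sub>c"
    and \<Delta>v: "(norm (v k s))\<^sup>2 \<le> \<omega>\<^sup>2 * \<kappa>\<^sub>c / \<kappa>\<^sub>v * \<Delta> k s" if s: "s \<in> space P" for k s
  proof -
    have cb: "norm (c (x k s)) \<le> \<kappa>\<^sub>c"
      using smoothness_constants(4)[OF s, of k] by blast
    note nd = normal_step_decrease[OF kappa_v(2)[OF s] kappa_v(1) v(2)[OF s] cb, folded \<Delta>_def]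
    show "0 \<le> \<Delta> k s"
      by (rule nd(1))
    show "\<Delta> k s \<le> \<kappa>\<^sub>c"
      unfolding \<Delta>_def using cb norm_ge_zero[of "c (x k s) + J (x k s) *v v k s"] by linarith
    have "\<kappa>\<^sub>v * (norm (v k s))\<^sup>2 \<le> \<kappa>\<^sub>v * (\<omega> * norm (transpose (J (x k s)) *v c (x k s)))\<^sup>2"
      using v(2)[OF s, of k] kappa_v(1) by (intro mult_left_mono power_mono) auto
    also have "\<dots> = \<omega>\<^sup>2 * (\<kappa>\<^sub>v * (norm (transpose (J (x k s)) *v c (x k s)))\<^sup>2)"
      by (simp add: power_mult_distrib)
    also have "\<dots> \<le> \<omega>\<^sup>2 * (\<kappa>\<^sub>c * \<Delta> k s)"
      by (intro mult_left_mono nd(2)) simp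
    finally show "(norm (v k s))\<^sup>2 \<le> \<omega>\<^sup>2 * \<kappa>\<^sub>c / \<kappa>\<^sub>v * \<Delta> k s"
      using kappa_v(1) by (simp add: field_simps)
  qed
  have q0: "0 \<le> q k s" if "s \<in> space P" for k s
    unfolding q_def by (rule order_trans[OF _ ub(3)[OF that]]) (use hessian(1) in simp)
  have qu: "(norm (utrue k s))\<^sup>2 \<le> q k s / \<zeta>" if "s \<in> space P" for k s
    using ub(3)[OF that, of k] hessian(1) by (simp add: q_def field_simps)
  have decrease: "\<phi> (Suc k) s - \<phi> k s \<le> - \<nu> * (\<sigma> / 2 * \<Delta> k s + \<tau>\<^sub>m\<^sub>i\<^sub>n * \<beta> k * q k s) - W k s \<bullet> e k s
      + (\<beta> k)\<^sup>2 * (1/2 * S * (inverse \<zeta> * \<kappa>\<^sub>H * \<kappa>\<^sub>u\<^sup>2 + (inverse \<zeta>)\<^sup>2 * (norm (e k s))\<^sup>2)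
        + \<theta> * \<kappa>\<^sub>g * \<tau>\<^sub>m\<^sub>i\<^sub>n * inverse \<zeta> * norm (e k s) + \<theta>\<^sup>2 * S * \<omega>\<^sup>2 * \<kappa>\<^sub>J\<^sup>2 * \<kappa>\<^sub>c\<^sup>2)"
    if s: "s \<in> space P" for k s
  proof -
    have "x k s + \<alpha> k s *\<^sub>R (\<beta> k *\<^sub>R u k s + v k s) \<in> X"
      using X(3)[OF s, of "Suc k"] by (simp add: step(3)[OF s])
    then show ?thesis
      unfolding \<phi>_def \<Delta>_def q_def e_def W_def S_def step(3)[OF s]
      by (intro merit_decrease[where X = X and J = J and B = "H k s" and ut = "utrue k s"])
        (use X(2) X(3)[OF s] f c J smoothness_constants(4)[OF s, of k] hessian(1) hessian(2)[OF s]
          \<nu>(1) \<beta>(1)[of k] merit(1,3) kappa_v(1) smoothness_constants(2) stepsize(1) \<omega> S v[OF s, of k]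
          u[OF s] ut[OF s] w1[OF s] w2[OF s] \<alpha>[OF s, of k] merit(4)[OF s, of k]
          kappa_v(2)[OF s, of k] \<nu>S kappa_u dtrue[OF s, of k] in \<open>auto simp: S_def\<close>)
  qed
  have W: "norm (W k s) \<le> \<nu> * \<tau>\<^sub>m\<^sub>i\<^sub>n * \<beta> k * (\<kappa>\<^sub>g / \<zeta>) + (\<beta> k)\<^sup>2 * S * (\<kappa>\<^sub>u / \<zeta>)"
    if s: "s \<in> space P" for k s
  proof -
    have "\<zeta> * norm (w1 k s) \<le> \<kappa>\<^sub>g"
      using reduced_solution_coercive[OF H(3)[OF s] hessian(1) w1[OF s]] smoothness_constants(4)[OF s, of k]
      by (meson order_trans)
    then have 1: "norm (w1 k s) \<le> \<kappa>\<^sub>g / \<zeta>"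
      using hessian(1) by (simp add: field_simps)
    have "\<zeta> * norm (w2 k s) \<le> \<kappa>\<^sub>u"
      using reduced_solution_coercive[OF H(3)[OF s] hessian(1) w2[OF s]] ub(1)[OF s, of k]
      by (meson order_trans)
    then have 2: "norm (w2 k s) \<le> \<kappa>\<^sub>u / \<zeta>"
      using hessian(1) by (simp add: field_simps)
    have "norm (W k s) \<le> \<nu> * \<tau>\<^sub>m\<^sub>i\<^sub>n * \<beta> k * norm (w1 k s) + (\<beta> k)\<^sup>2 * S * norm (w2 k s)"
      unfolding W_def using \<nu>(1) merit(3) \<beta>(1)[of k] S by (intro order_trans[OF norm_triangle_ineq]) simp
    also have "\<dots> \<le> \<nu> * \<tau>\<^sub>m\<^sub>i\<^sub>n * \<beta> k * (\<kappa>\<^sub>g / \<zeta>) + (\<beta> k)\<^sup>2 * S * (\<kappa>\<^sub>u / \<zeta>)"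
      using \<nu>(1) merit(3) \<beta>(1)[of k] S 1 2 by (intro add_mono mult_left_mono) auto
    finally show ?thesis .
  qed
  have measW: "W k \<in> borel_measurable (F k)" for k
    unfolding W_def using measw1 measw2 by measurable
  have grad: "g k \<in> borel_measurable P"
    "AE s in P. real_cond_exp P (F k) (\<lambda>s. g k s $ i) s = gradf (x k s) $ i"
    "AE s in P. nn_cond_exp P (F k) (\<lambda>s. ennreal ((norm (g k s - gradf (x k s)))\<^sup>2)) s \<le> ennreal M"
    for k i
    using gradient(2) by (auto simp: gradient_assumption_def)
  have gradb: "norm (gradf (x k s)) \<le> \<kappa>\<^sub>g" if "s \<in> space P" for k s
    using smoothness_constants(4)[OF that] by blast
  note noise_raw = conditional_noise[OF sub grad(1) measgrad gradb grad(2,3) gradient(1), folded e_def]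
  have noise: "integrable P (\<lambda>s. (norm (e k s))\<^sup>2)" "expectation (\<lambda>s. (norm (e k s))\<^sup>2) \<le> M"
    "integrable P (\<lambda>s. norm (e k s))" "expectation (\<lambda>s. norm (e k s)) \<le> sqrt M" for k
    by (rule noise_raw(1-4), assumption)+
  have noiseW: "integrable P (\<lambda>s. W k s \<bullet> e k s)" "expectation (\<lambda>s. W k s \<bullet> e k s) = 0" for k
    using noise_raw(5)[OF _ measW W] by blast+
  note measJ' = measurable_from_subalg[OF sub measJ] and measf' = measurable_from_subalg[OF sub measf]
    and measc' = measurable_from_subalg[OF sub measc] and measv' = measurable_from_subalg[OF sub meas(2)]
    and measH' = measurable_from_subalg[OF sub meas(3)] and measut' = measurable_from_subalg[OF sub measut]
  have int\<Delta>: "integrable P (\<Delta> k)" for k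
  proof (rule integrable_const_bound)
    show "AE s in P. norm (\<Delta> k s) \<le> \<kappa>\<^sub>c"
      using \<Delta>0 \<Delta>c by (intro AE_I2) simp
    show "\<Delta> k \<in> borel_measurable P"
      unfolding \<Delta>_def
      by (intro borel_measurable_diff measurable_compose[OF _ borel_measurable_norm] borel_measurable_add
          borel_measurable_matrix_vector_mult measc' measJ' measv')
  qed
  have intq: "integrable P (q k)" for k
  proof (rule integrable_const_bound)
    show "AE s in P. norm (q k s) \<le> \<kappa>\<^sub>H * \<kappa>\<^sub>u\<^sup>2"
      using q0 ub(2) by (intro AE_I2) (simp add: q_def)
    show "q k \<in> borel_measurable P"
      unfolding q_def
      by (intro borel_measurable_inner borel_measurable_matrix_vector_mult measut' measH')
  qed
  \<comment> \<open>The constant \<open>f\<^sub>i\<^sub>n\<^sub>f\<close> bounds \<open>f\<close>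
    from below only; integrability of the merit function needs a two-sided bound.\<close>
  obtain b where b: "\<And>z. z \<in> X \<Longrightarrow> \<bar>f z\<bar> \<le> b"
    using f_bdd by (auto simp: bounded_iff)
  have int\<phi>: "integrable P (\<phi> k)" for k
    unfolding \<phi>_def
  proof (intro Bochner_Integration.integrable_add Bochner_Integration.integrable_mult_right)
    show "integrable P (\<lambda>s. f (x k s))"
      by (rule integrable_const_bound[where B = b]) (use b X(3) in \<open>auto intro!: AE_I2 measf'\<close>)
    show "integrable P (\<lambda>s. norm (c (x k s)))"
      by (rule integrable_const_bound[where B = \<kappa>\<^sub>c])
        (use smoothness_constants(4) in \<open>auto intro!: AE_I2 measurable_compose[OF _ borel_measurable_norm] measc'\<close>)
  qed
  have edecrease: "\<nu> * (\<sigma> / 2 * expectation (\<Delta> k) + \<tau>\<^sub>m\<^sub>i\<^sub>n * \<beta> k * expectation (q k))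
      \<le> expectation (\<phi> k) - expectation (\<phi> (Suc k)) + (\<beta> k)\<^sup>2 * \<kappa>\<^sub>1" for k
  proof -
    let ?r = "\<lambda>s. - \<nu> * (\<sigma> / 2 * \<Delta> k s + \<tau>\<^sub>m\<^sub>i\<^sub>n * \<beta> k * q k s) - W k s \<bullet> e k s
      + (\<beta> k)\<^sup>2 * (1/2 * S * (inverse \<zeta> * \<kappa>\<^sub>H * \<kappa>\<^sub>u\<^sup>2 + (inverse \<zeta>)\<^sup>2 * (norm (e k s))\<^sup>2)
        + \<theta> * \<kappa>\<^sub>g * \<tau>\<^sub>m\<^sub>i\<^sub>n * inverse \<zeta> * norm (e k s) + \<theta>\<^sup>2 * S * \<omega>\<^sup>2 * \<kappa>\<^sub>J\<^sup>2 * \<kappa>\<^sub>c\<^sup>2)"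
    note ints = int\<Delta>[of k] intq[of k] noiseW(1)[of k] noise(1)[of k] noise(3)[of k]
    have "expectation (\<phi> (Suc k)) - expectation (\<phi> k) = expectation (\<lambda>s. \<phi> (Suc k) s - \<phi> k s)"
      using int\<phi> by simp
    also have "\<dots> \<le> expectation ?r"
      by (intro integral_mono decrease) (use ints int\<phi> in simp_all)
    also have "\<dots> = - \<nu> * (\<sigma> / 2 * expectation (\<Delta> k) + \<tau>\<^sub>m\<^sub>i\<^sub>n * \<beta> k * expectation (q k))
      + (\<beta> k)\<^sup>2 * (1/2 * S * (inverse \<zeta> * \<kappa>\<^sub>H * \<kappa>\<^sub>u\<^sup>2
          + (inverse \<zeta>)\<^sup>2 * expectation (\<lambda>s. (norm (e k s))\<^sup>2))
        + \<theta> * \<kappa>\<^sub>g * \<tau>\<^sub>m\<^sub>i\<^sub>n * inverse \<zeta> * expectation (\<lambda>s. norm (e k s))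
        + \<theta>\<^sup>2 * S * \<omega>\<^sup>2 * \<kappa>\<^sub>J\<^sup>2 * \<kappa>\<^sub>c\<^sup>2)"
      using ints by (simp add: noiseW(2) prob_space)
    \<comment> \<open>Replacing the two noise moments by \<open>M\<close> and \<open>sqrt M\<close>
      turns the error factor into exactly \<open>\<kappa>\<^sub>1\<close>.\<close>
    also have "\<dots> \<le> - \<nu> * (\<sigma> / 2 * expectation (\<Delta> k) + \<tau>\<^sub>m\<^sub>i\<^sub>n * \<beta> k * expectation (q k))
      + (\<beta> k)\<^sup>2 * \<kappa>\<^sub>1"
      unfolding kappa_1 S_def[symmetric]
      using S stepsize(1) smoothness_constants(1) merit(3) hessian(1) noise(2,4)[of k]
      by (intro add_left_mono mult_left_mono add_mono order_refl) auto
    finally show ?thesis by simp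
  qed
  let ?\<beta> = "\<eta> / sqrt (real K)"
  let ?A = "\<Sum>k<K. expectation (\<Delta> k)" and ?Q = "\<Sum>k<K. expectation (q k)"
  have "\<nu> * (\<sigma> / 2 * ?A + \<tau>\<^sub>m\<^sub>i\<^sub>n * ?\<beta> * ?Q)
    = (\<Sum>k<K. \<nu> * (\<sigma> / 2 * expectation (\<Delta> k) + \<tau>\<^sub>m\<^sub>i\<^sub>n * ?\<beta> * expectation (q k)))"
    by (simp only: sum_distrib_left sum.distrib distrib_left)
  also have "\<dots> = (\<Sum>k<K. \<nu> * (\<sigma> / 2 * expectation (\<Delta> k) + \<tau>\<^sub>m\<^sub>i\<^sub>n * \<beta> k * expectation (q k)))"
    using horizon(3) by (intro sum.cong) simp_all
  also have "\<dots> \<le> (\<Sum>k<K. expectation (\<phi> k) - expectation (\<phi> (Suc k)) + (\<beta> k)\<^sup>2 * \<kappa>\<^sub>1)"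
    by (intro sum_mono edecrease)
  also have "\<dots> = expectation (\<phi> 0) - expectation (\<phi> K) + real K * (?\<beta>\<^sup>2 * \<kappa>\<^sub>1)"
    using horizon(3) sum_lessThan_telescope'[of "\<lambda>k. expectation (\<phi> k)" K] by (simp add: sum.distrib)
  \<comment> \<open>The scaling of \<beta> by \<open>1 / sqrt K\<close> makes the accumulated error,
    and with it \<open>\<kappa>\<^sub>2\<close>, independent of the horizon.\<close>
  also have "real K * (?\<beta>\<^sup>2 * \<kappa>\<^sub>1) = \<eta>\<^sup>2 * \<kappa>\<^sub>1"
    using horizon(1) by (simp add: power_divide)
  also have "expectation (\<phi> 0) = \<tau>\<^sub>m\<^sub>i\<^sub>n * f x0 + norm (c x0)"
  proof -
    have "expectation (\<phi> 0) = expectation (\<lambda>s. \<tau>\<^sub>m\<^sub>i\<^sub>n * f x0 + norm (c x0))"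
      by (rule Bochner_Integration.integral_cong) (simp_all add: \<phi>_def x0)
    then show ?thesis
      by (simp add: prob_space)
  qed
  also have "\<tau>\<^sub>m\<^sub>i\<^sub>n * f x0 + norm (c x0) - expectation (\<phi> K) + \<eta>\<^sup>2 * \<kappa>\<^sub>1 \<le> \<kappa>\<^sub>2"
  proof -
    have "\<tau>\<^sub>m\<^sub>i\<^sub>n * f\<^sub>i\<^sub>n\<^sub>f \<le> \<phi> K s" if "s \<in> space P" for s
      using smoothness_constants(4)[OF that, of K] merit(3) by (simp add: \<phi>_def add_increasing2)
    then have "expectation (\<lambda>s. \<tau>\<^sub>m\<^sub>i\<^sub>n * f\<^sub>i\<^sub>n\<^sub>f) \<le> expectation (\<phi> K)"
      using int\<phi> by (intro integral_mono) auto
    then show ?thesis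
      by (simp add: prob_space kappa_2 algebra_simps)
  qed
  finally have AQ: "\<nu> * (\<sigma> / 2 * ?A + \<tau>\<^sub>m\<^sub>i\<^sub>n * ?\<beta> * ?Q) \<le> \<kappa>\<^sub>2" .
  have residual: "gradf (x k s) + transpose (J (x k s)) *v ytrue k s = - (H k s *v (v k s + utrue k s))"
    if s: "s \<in> space P" for k s
  proof -
    let ?r = "gradf (x k s) + H k s *v v k s + H k s *v utrue k s"
    \<comment> \<open>Optimality of \<open>utrue\<close> makes \<open>?r\<close> orthogonal to the
      null space of the Jacobian. On the row space the pseudoinverse is a right inverse, so the
      multiplier term reproduces \<open>- ?r\<close> exactly.\<close>
    have "?r \<in> range ((*v) (transpose (J (x k s))))"
      using ut[OF s, of k]
      by (intro orthogonal_null_in_range) (auto simp: reduced_solution_def inner_add_left inner_diff_left)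
    then have "transpose (J (x k s)) *v ytrue k s = - ?r"
      unfolding ytrue[OF s] linear_neg[OF matrix_vector_mul_linear] by (simp only: pinv_range)
    then show ?thesis
      by (simp add: matrix_vector_right_distrib)
  qed
  have R: "expectation (\<lambda>s. (norm (gradf (x k s) + transpose (J (x k s)) *v ytrue k s))\<^sup>2)
      \<le> \<kappa>\<^sub>H\<^sup>2 * (\<omega>\<^sup>2 * \<kappa>\<^sub>c / \<kappa>\<^sub>v * expectation (\<Delta> k) + expectation (q k) / \<zeta>)" for k
  proof -
    let ?b = "\<lambda>s. \<kappa>\<^sub>H\<^sup>2 * (\<omega>\<^sup>2 * \<kappa>\<^sub>c / \<kappa>\<^sub>v * \<Delta> k s + q k s / \<zeta>)"
    have *: "(norm (gradf (x k s) + transpose (J (x k s)) *v ytrue k s))\<^sup>2 \<le> ?b s" if s: "s \<in> space P" for s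
    proof -
      have "J (x k s) *v utrue k s = 0"
        using ut[OF s] by (simp add: reduced_solution_def)
      then have orth: "v k s \<bullet> utrue k s = 0"
        using range_orthogonal_null[OF v(1)[OF s]] by blast
      have "(norm (gradf (x k s) + transpose (J (x k s)) *v ytrue k s))\<^sup>2
          \<le> (\<kappa>\<^sub>H * norm (v k s + utrue k s))\<^sup>2"
        unfolding residual[OF s] norm_minus_cancel
        by (intro power_mono op_norm_bound H(2)[OF s]) simp
      also have "\<dots> = \<kappa>\<^sub>H\<^sup>2 * ((norm (v k s))\<^sup>2 + (norm (utrue k s))\<^sup>2)"
        by (simp add: power_mult_distrib norm_pythagoras[OF orth])
      also have "\<dots> \<le> ?b s"
        by (intro mult_left_mono add_mono \<Delta>v qu s) simp
      finally show ?thesis .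
    qed
    have "expectation (\<lambda>s. (norm (gradf (x k s) + transpose (J (x k s)) *v ytrue k s))\<^sup>2) \<le> expectation ?b"
      \<comment> \<open>\<open>integral_mono'\<close> takes integrability of the dominating side:
        the Bochner integral of a nonintegrable function is 0 by convention, which still lies below
        a nonnegative bound.\<close>
      by (rule integral_mono'[OF _ *]) (use int\<Delta> intq in simp, simp, rule order_trans[OF _ *], simp_all)
    also have "\<dots> = \<kappa>\<^sub>H\<^sup>2 * (\<omega>\<^sup>2 * \<kappa>\<^sub>c / \<kappa>\<^sub>v * expectation (\<Delta> k) + expectation (q k) / \<zeta>)"
      using int\<Delta> intq by simp
    finally show ?thesis .
  qed
  have "(\<Sum>k<K. expectation (\<lambda>s. (norm (gradf (x k s) + transpose (J (x k s)) *v ytrue k s))\<^sup>2))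
      \<le> (\<Sum>k<K. \<kappa>\<^sub>H\<^sup>2 * (\<omega>\<^sup>2 * \<kappa>\<^sub>c / \<kappa>\<^sub>v * expectation (\<Delta> k) + expectation (q k) / \<zeta>))"
    by (intro sum_mono R)
  also have "\<dots> = \<kappa>\<^sub>H\<^sup>2 * (\<omega>\<^sup>2 * \<kappa>\<^sub>c / \<kappa>\<^sub>v * ?A + ?Q / \<zeta>)"
    by (simp only: sum_distrib_left sum.distrib distrib_left sum_divide_distrib)
  finally have RAQ: "(\<Sum>k<K. expectation (\<lambda>s. (norm (gradf (x k s) + transpose (J (x k s)) *v ytrue k s))\<^sup>2))
      \<le> \<kappa>\<^sub>H\<^sup>2 * (\<omega>\<^sup>2 * \<kappa>\<^sub>c / \<kappa>\<^sub>v * ?A + ?Q / \<zeta>)" .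
  have "0 \<le> ?A" "0 \<le> ?Q"
    using \<Delta>0 q0 by (auto intro!: sum_nonneg Bochner_Integration.integral_nonneg_AE AE_I2)
  moreover have "0 < real K"
    using horizon(1) by simp
  ultimately show ?thesis
    by (intro complexity_algebra[OF \<nu>(1) merit(1,3) horizon(2) hessian(1) kappa_v(1)
          smoothness_constants(2) _ \<omega> _ _ \<kappa>H RAQ AQ kappa_0])
qed

end
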